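(* For $\underline{\alpha}=(\alpha_1,\dots,\alpha_n)\in(\mathbb{K}^* )^n$ let $M(\underline{\alpha})$ be the $\mathbb{K}$-vector space with basis $e(a_1,\dots,a_s)$, where $0\le a_i\le k_i-1$ for $1\le i\le s$. Then there is a right $\mathbb{A}_{\mathbf{q}}$-module structure on $M(\underline{\alpha})$ defined by \begin{align*} e(a_1,\dots,a_s)X_i&=\alpha_i\, e(a_1,\dots,a_i+_i 1,\dots,a_s), && 1\le i\le s,\\ e(a_1,\dots,a_s)X_{i+s}&=\alpha_i^{-1}\alpha_{i+s}\,(q^{h_i})^{a_i-1}\, e(a_1,\dots,a_i+_i(-1),\dots,a_s), && 1\le i\le s,\\ e(a_1,\dots,a_s)X_{2s+j}&=\alpha_{2s+j}\, e(a_1,\dots,a_s), && 1\le j\le n-2s, \end{align*} where $+_i$ denotes addition in $\mathbb{Z}/k_i\mathbb{Z}$ (with representatives $0,\dots,k_i-1$). Moreover, $M(\underline{\alpha})$ is a simple $\mathbb{A}_{\mathbf{q}}$-module of dimension $\prod_{i=1}^s k_i$ over $\mathbb{K}$.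
   Context: $\mathbb{K}$ is an algebraically closed field, $\mathbb{K}^*=\mathbb{K}\setminus\{0\}$, and "module" means right module. $\mathbf{q}=(q_{ij})$ is an $n\times n$ multiplicatively antisymmetric matrix over $\mathbb{K}^*$ (that is, $q_{ii}=1$ and $q_{ji}=q_{ij}^{-1}$), and the subgroup of $\mathbb{K}^*$ generated by the $q_{ij}$ is assumed torsion, hence finite cyclic; let $m$ be its order and $q$ a generator. The quantum torus $\mathbb{A}_{\mathbf{q}}$ is the $\mathbb{K}$-algebra generated by $x_1^{\pm1},\dots,x_n^{\pm1}$ with relations $x_ix_j=q_{ij}x_jx_i$ for all $i,j$. Normal form (standing convention): $\mathbb{A}_{\mathbf{q}}$ is assumed to be in the form $$\mathbb{A}_{\mathbf{q}}\cong \mathbb{A}_{q^{h_1}}\otimes\mathbb{A}_{q^{h_2}}\otimes\cdots\otimes\mathbb{A}_{q^{h_s}}\otimes\mathbb{K}[\mathbb{Z}^{n-2s}],$$ where $2s\le n$, $h_1=1$, each $h_i$ is a positive divisor of $m$ with $h_i<m$, $h_2\mid h_3\mid\cdots\mid h_s$, and $\mathbb{A}_{q^{h_i}}$ is the rank-2 quantum torus generated by $X_i^{\pm1},X_{i+s}^{\pm1}$ with $X_iX_{i+s}=q^{h_i}X_{i+s}X_i$; the group algebra $\mathbb{K}[\mathbb{Z}^{n-2s}]$ is generated by $X_{2s+1}^{\pm1},\dots,X_n^{\pm1}$. Thus, via a fixed isomorphism, $\mathbb{A}_{\mathbf{q}}$ is the $\mathbb{K}$-algebra generated by $X_1^{\pm1},\dots,X_n^{\pm1}$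 with defining relations $X_iX_{i+s}=q^{h_i}X_{i+s}X_i$ for $1\le i\le s$, all other pairs of the $X_k$ commuting; the $X_k$ are monomials in the $x_j^{\pm1}$. Put $k_i:=m/h_i$ for $1\le i\le s$. *)

theory Defs
  imports
    "HOL-Algebra.QuotRing"
    "HOL-Algebra.Module"
    "HOL-Algebra.Generated_Groups"
    "HOL-Computational_Algebra.Polynomial"
    "HOL-Library.Poly_Mapping"
begin

section \<open>Multiplicatively antisymmetric matrices\<close>

definition unit_group :: "'k::field monoid" where
  "unit_group = \<lparr>carrier = UNIV - {0}, monoid.mult = (*), one = 1\<rparr>"

definition mult_antisymmetric :: "nat \<Rightarrow> (nat \<Rightarrow> nat \<Rightarrow> 'k::field) \<Rightarrow> bool" where
  "mult_antisymmetric n Q \<longleftrightarrow>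
     (\<forall>i\<in>{1..n}. \<forall>j\<in>{1..n}. Q i j \<noteq> 0 \<and> Q j i = inverse (Q i j)) \<and>
     (\<forall>i\<in>{1..n}. Q i i = 1)"

definition entry_group :: "nat \<Rightarrow> (nat \<Rightarrow> nat \<Rightarrow> 'k::field) \<Rightarrow> 'k set" where
  "entry_group n Q = generate unit_group {Q i j | i j. i \<in> {1..n} \<and> j \<in> {1..n}}"


section \<open>The free associative algebra\<close>

text \<open>The finitely supported functions on a (multiplicatively thought of) monoid, with the
  convolution product of \<^typ>\<open>'a \<Rightarrow>\<^sub>0 'b\<close>, form its monoid algebra. The library writes
  the monoid additively, so concatenation of words is \<open>+\<close> and the empty word is \<open>0\<close>.\<close>

datatype letter = Gen nat | Inv nat

datatype word = Word (letters: "letter list")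

instantiation word :: monoid_add
begin

definition zero_word :: word where "zero_word = Word []"

definition plus_word :: "word \<Rightarrow> word \<Rightarrow> word" where
  "plus_word u v = Word (letters u @ letters v)"

instance
  by standard (simp_all add: zero_word_def plus_word_def)

end

definition words :: "nat \<Rightarrow> word set" where
  "words n = {w. set (letters w) \<subseteq> Gen ` {1..n} \<union> Inv ` {1..n}}"

definition scale_pm :: "'k::field \<Rightarrow> ('a \<Rightarrow>\<^sub>0 'k) \<Rightarrow> 'a \<Rightarrow>\<^sub>0 'k" where
  "scale_pm c p = Poly_Mapping.map ((*) c) p"

lemma lookup_scale_pm: "Poly_Mapping.lookup (scale_pm c p) a = c * Poly_Mapping.lookup p a"
  by (simp add: scale_pm_def Poly_Mapping.map.rep_eq when_def)

lemma vector_space_scale_pm: "vector_space (scale_pm :: 'k::field \<Rightarrow> ('a \<Rightarrow>\<^sub>0 'k) \<Rightarrow> _)"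
  by standard
    (auto intro!: poly_mapping_eqI simp: lookup_scale_pm lookup_add algebra_simps)

definition mono_word :: "letter list \<Rightarrow> word \<Rightarrow>\<^sub>0 'k::field" where
  "mono_word ls = Poly_Mapping.single (Word ls) 1"

definition free_algebra :: "nat \<Rightarrow> ('k::field, word \<Rightarrow>\<^sub>0 'k) module" where
  "free_algebra n =
     \<lparr>carrier = {p. Poly_Mapping.keys p \<subseteq> words n}, monoid.mult = (*), one = 1,
      zero = 0, add = (+), module.smult = scale_pm\<rparr>"


section \<open>Quantum tori\<close>

definition torus_relators :: "nat \<Rightarrow> (nat \<Rightarrow> nat \<Rightarrow> 'k::field) \<Rightarrow> (word \<Rightarrow>\<^sub>0 'k) set" where
  "torus_relators n Q =
     {mono_word [Gen i, Inv i] - 1 | i. i \<in> {1..n}} \<union>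
     {mono_word [Inv i, Gen i] - 1 | i. i \<in> {1..n}} \<union>
     {mono_word [Gen i, Gen j] - scale_pm (Q i j) (mono_word [Gen j, Gen i])
       | i j. i \<in> {1..n} \<and> j \<in> {1..n}}"

definition torus_ideal :: "nat \<Rightarrow> (nat \<Rightarrow> nat \<Rightarrow> 'k::field) \<Rightarrow> (word \<Rightarrow>\<^sub>0 'k) set" where
  "torus_ideal n Q = genideal (free_algebra n) (torus_relators n Q)"

definition torus_class ::
    "nat \<Rightarrow> (nat \<Rightarrow> nat \<Rightarrow> 'k::field) \<Rightarrow> (word \<Rightarrow>\<^sub>0 'k) \<Rightarrow> (word \<Rightarrow>\<^sub>0 'k) set" where
  "torus_class n Q p = torus_ideal n Q +>\<^bsub>free_algebra n\<^esub> p"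

text \<open>\<^const>\<open>FactRing\<close> only yields a ring record; the scalar multiplication
  \<open>c \<odot> (I + p) = I + c p\<close> is added to it, written setwise as in \<^const>\<open>rcoset_mult\<close>.\<close>

definition quantum_torus ::
    "nat \<Rightarrow> (nat \<Rightarrow> nat \<Rightarrow> 'k::field) \<Rightarrow> ('k, (word \<Rightarrow>\<^sub>0 'k) set) module" where
  "quantum_torus n Q =
     ring.extend (free_algebra n Quot torus_ideal n Q)
       (module.fields (\<lambda>c C. \<Union>p\<in>C. torus_class n Q (scale_pm c p)))"

definition torus_gen :: "nat \<Rightarrow> (nat \<Rightarrow> nat \<Rightarrow> 'k::field) \<Rightarrow> nat \<Rightarrow> (word \<Rightarrow>\<^sub>0 'k) set" where
  "torus_gen n Q i = torus_class n Q (mono_word [Gen i])"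

definition torus_monomials :: "nat \<Rightarrow> (nat \<Rightarrow> nat \<Rightarrow> 'k::field) \<Rightarrow> (word \<Rightarrow>\<^sub>0 'k) set set" where
  "torus_monomials n Q =
     {torus_class n Q (Poly_Mapping.single w c) | w c. w \<in> words n \<and> c \<noteq> 0}"

definition algebra_iso ::
    "('k, 'a, 'x) module_scheme \<Rightarrow> ('k, 'b, 'y) module_scheme \<Rightarrow> ('a \<Rightarrow> 'b) set" where
  "algebra_iso A B =
     {\<phi> \<in> ring_iso A B. \<forall>c. \<forall>x\<in>carrier A. \<phi> (c \<odot>\<^bsub>A\<^esub> x) = c \<odot>\<^bsub>B\<^esub> \<phi> x}"

text \<open>The matrix of the presentation with \<open>X\<^sub>i X\<^sub>i\<^sub>+\<^sub>s = q\<^bsup>h i\<^esup> X\<^sub>i\<^sub>+\<^sub>s X\<^sub>i\<close>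
  for \<open>1 \<le> i \<le> s\<close>, all other pairs of generators commuting.\<close>

definition normal_matrix :: "'k::field \<Rightarrow> nat \<Rightarrow> (nat \<Rightarrow> nat) \<Rightarrow> nat \<Rightarrow> nat \<Rightarrow> 'k" where
  "normal_matrix q s h i j =
     (if i \<in> {1..s} \<and> j = i + s then q ^ h i
      else if j \<in> {1..s} \<and> i = j + s then inverse (q ^ h j)
      else 1)"


section \<open>Right modules over a (noncommutative) algebra\<close>

text \<open>A right module structure on a subspace \<open>V\<close> of an ambient vector space with scalar
  multiplication \<open>scl\<close>; the last clause says that the scalars of the algebra act on
  \<open>V\<close> through \<open>scl\<close>.\<close>

definition right_module ::
    "('k::field, 'a, 'x) module_scheme \<Rightarrow> ('k \<Rightarrow> 'v::ab_group_add \<Rightarrow> 'v) \<Rightarrow> 'v set \<Rightarrow>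
     ('v \<Rightarrow> 'a \<Rightarrow> 'v) \<Rightarrow> bool" where
  "right_module A scl V act \<longleftrightarrow>
     vector_space scl \<and> Modules.module.subspace scl V \<and>
     (\<forall>v\<in>V. \<forall>x\<in>carrier A. act v x \<in> V) \<and>
     (\<forall>u\<in>V. \<forall>v\<in>V. \<forall>x\<in>carrier A. act (u + v) x = act u x + act v x) \<and>
     (\<forall>v\<in>V. \<forall>x\<in>carrier A. \<forall>y\<in>carrier A. act v (x \<oplus>\<^bsub>A\<^esub> y) = act v x + act v y) \<and>
     (\<forall>v\<in>V. \<forall>x\<in>carrier A. \<forall>y\<in>carrier A. act v (x \<otimes>\<^bsub>A\<^esub> y) = act (act v x) y) \<and>
     (\<forall>v\<in>V. act v \<one>\<^bsub>A\<^esub> = v) \<and>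
     (\<forall>c. \<forall>v\<in>V. \<forall>x\<in>carrier A.
        act (scl c v) x = scl c (act v x) \<and> act v (c \<odot>\<^bsub>A\<^esub> x) = scl c (act v x))"

definition right_submodule ::
    "('k::field, 'a, 'x) module_scheme \<Rightarrow> 'v::ab_group_add set \<Rightarrow> ('v \<Rightarrow> 'a \<Rightarrow> 'v) \<Rightarrow>
     'v set \<Rightarrow> bool" where
  "right_submodule A V act W \<longleftrightarrow>
     W \<subseteq> V \<and> 0 \<in> W \<and> (\<forall>u\<in>W. \<forall>v\<in>W. u + v \<in> W) \<and> (\<forall>v\<in>W. - v \<in> W) \<and>
     (\<forall>v\<in>W. \<forall>x\<in>carrier A. act v x \<in> W)"

definition simple_right_module ::
    "('k::field, 'a, 'x) module_scheme \<Rightarrow> ('k \<Rightarrow> 'v::ab_group_add \<Rightarrow> 'v) \<Rightarrow> 'v set \<Rightarrow>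
     ('v \<Rightarrow> 'a \<Rightarrow> 'v) \<Rightarrow> bool" where
  "simple_right_module A scl V act \<longleftrightarrow>
     right_module A scl V act \<and> V \<noteq> {0} \<and>
     (\<forall>W. right_submodule A V act W \<longrightarrow> W = {0} \<or> W = V)"


section \<open>The space \<open>M(\<alpha>)\<close> and its prescribed action\<close>

definition M_index :: "nat \<Rightarrow> (nat \<Rightarrow> nat) \<Rightarrow> (nat \<Rightarrow> nat) set" where
  "M_index s k = (\<Pi>\<^sub>E i\<in>{1..s}. {0..<k i})"

definition M_space :: "nat \<Rightarrow> (nat \<Rightarrow> nat) \<Rightarrow> ((nat \<Rightarrow> nat) \<Rightarrow>\<^sub>0 'k::field) set" where
  "M_space s k = {v. Poly_Mapping.keys v \<subseteq> M_index s k}"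

definition basis_vec :: "(nat \<Rightarrow> nat) \<Rightarrow> ((nat \<Rightarrow> nat) \<Rightarrow>\<^sub>0 'k::field)" where
  "basis_vec a = Poly_Mapping.single a 1"

definition shift :: "(nat \<Rightarrow> nat) \<Rightarrow> nat \<Rightarrow> int \<Rightarrow> (nat \<Rightarrow> nat) \<Rightarrow> nat \<Rightarrow> nat" where
  "shift k i d a = a(i := nat ((int (a i) + d) mod int (k i)))"

definition M_action ::
    "('k::field, 'a, 'x) module_scheme \<Rightarrow> (nat \<Rightarrow> 'a) \<Rightarrow> nat \<Rightarrow> nat \<Rightarrow> 'k \<Rightarrow> (nat \<Rightarrow> nat) \<Rightarrow>
     (nat \<Rightarrow> nat) \<Rightarrow> (nat \<Rightarrow> 'k) \<Rightarrow>
     (((nat \<Rightarrow> nat) \<Rightarrow>\<^sub>0 'k) \<Rightarrow> 'a \<Rightarrow> ((nat \<Rightarrow> nat) \<Rightarrow>\<^sub>0 'k)) \<Rightarrow> bool" where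
  "M_action A X n s q h k \<alpha> act \<longleftrightarrow>
     right_module A scale_pm (M_space s k) act \<and>
     (\<forall>a\<in>M_index s k.
        (\<forall>i\<in>{1..s}. act (basis_vec a) (X i) = scale_pm (\<alpha> i) (basis_vec (shift k i 1 a))) \<and>
        (\<forall>i\<in>{1..s}. act (basis_vec a) (X (i + s)) =
           scale_pm (inverse (\<alpha> i) * \<alpha> (i + s) * (q ^ h i) powi (int (a i) - 1))
             (basis_vec (shift k i (- 1) a))) \<and>
        (\<forall>j\<in>{1..n - 2 * s}. act (basis_vec a) (X (2 * s + j)) = scale_pm (\<alpha> (2 * s + j)) (basis_vec a)))"

end

theory Submission
  imports Defs "HOL-Algebra.Multiplicative_Group"
begin

text \<open>Right modules over a quantum torus are the same as families of invertible operators satisfying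
  the commutation relations, so existence amounts to checking
  \<open>X\<^sub>i X\<^sub>i\<^sub>+\<^sub>s = q\<^bsup>h i\<^esup> X\<^sub>i\<^sub>+\<^sub>s X\<^sub>i\<close> on basis vectors; this holds also
  across the wrap-around since \<open>q\<^bsup>h i\<^esup>\<close> is a \<open>k i\<close>-th root of unity. For simplicity, each product
  \<open>X\<^sub>i X\<^sub>i\<^sub>+\<^sub>s\<close> is diagonal with eigenvalue \<open>\<alpha>\<^sub>i\<^sub>+\<^sub>s (q\<^bsup>h i\<^esup>)\<^bsup>a i\<^esup>\<close> on \<open>e(a)\<close>. As
  \<open>q\<^bsup>h i\<^esup>\<close> has order exactly \<open>k i\<close>, these eigenvalues together separate the basis vectors, so a
  nonzero submodule contains an element of support one, and the \<open>X\<^sub>i\<close> with \<open>i \<le> s\<close> permute the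
  lines spanned by the basis vectors transitively.\<close>

section \<open>Monomial induction and linear extension\<close>

lemma poly_mapping_sum_singles:
  fixes p :: "'a \<Rightarrow>\<^sub>0 'b::comm_monoid_add"
  shows "p = (\<Sum>a\<in>Poly_Mapping.keys p. Poly_Mapping.single a (Poly_Mapping.lookup p a))"
  by (rule poly_mapping_eqI)
    (simp add: lookup_sum lookup_single when_def sum.delta' in_keys_iff)

text \<open>An element is the sum of the singles over its support. The bound \<open>S\<close>
  confines the induction to the free algebra (\<open>words n\<close>) or to the module
  (\<open>M_index s k\<close>).\<close>

lemma poly_mapping_keys_induct [consumes 1, case_names zero single add]:
  fixes p :: "'a \<Rightarrow>\<^sub>0 'b::comm_monoid_add"
  assumes keys: "Poly_Mapping.keys p \<subseteq> S"
    and "P 0"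
    and single: "\<And>a c. a \<in> S \<Longrightarrow> P (Poly_Mapping.single a c)"
    and add: "\<And>p q. Poly_Mapping.keys p \<subseteq> S \<Longrightarrow> Poly_Mapping.keys q \<subseteq> S \<Longrightarrow> P p \<Longrightarrow> P q \<Longrightarrow> P (p + q)"
  shows "P p"
proof -
  \<comment> \<open>The support bound is carried along because the hypothesis on sums asks for it on
    both summands.\<close>
  have "P (\<Sum>a\<in>A. Poly_Mapping.single a (Poly_Mapping.lookup p a)) \<and>
      Poly_Mapping.keys (\<Sum>a\<in>A. Poly_Mapping.single a (Poly_Mapping.lookup p a)) \<subseteq> S"
    if "finite A" "A \<subseteq> S" for A
    using that
  proof (induction A rule: finite_induct)
    case empty
    then show ?case using \<open>P 0\<close> by simp
  next
    case (insert a A)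
    let ?s = "Poly_Mapping.single a (Poly_Mapping.lookup p a)"
      and ?t = "\<Sum>a\<in>A. Poly_Mapping.single a (Poly_Mapping.lookup p a)"
    have "Poly_Mapping.keys ?s \<subseteq> S" "Poly_Mapping.keys ?t \<subseteq> S" "P ?s" "P ?t"
      using insert single by auto
    then have "P (?s + ?t)" "Poly_Mapping.keys (?s + ?t) \<subseteq> S"
      using add keys_add[of ?s ?t] by blast+
    then show ?case using insert.hyps by simp
  qed
  from this[OF finite_keys keys] show ?thesis
    using poly_mapping_sum_singles[of p] by simp
qed

lemma scale_pm_single: "scale_pm c (Poly_Mapping.single a d) = Poly_Mapping.single a (c * d)"
  by (rule poly_mapping_eqI) (simp add: lookup_scale_pm lookup_single when_def)

lemma keys_scale_pm: "Poly_Mapping.keys (scale_pm c p) \<subseteq> Poly_Mapping.keys p"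
  by (auto simp: in_keys_iff lookup_scale_pm)

text \<open>Scalars become elements of the monoid algebra, so ideals absorb them; this makes scaling
  of cosets well defined.\<close>

lemma scale_pm_conv_mult: "scale_pm c p = Poly_Mapping.single 0 c * p"
  for p :: "'a::monoid_add \<Rightarrow>\<^sub>0 'k::field"
proof -
  have "Poly_Mapping.keys p \<subseteq> UNIV" by simp
  then show ?thesis
  proof (induction p rule: poly_mapping_keys_induct)
    case zero
    show ?case by (rule poly_mapping_eqI) (simp add: lookup_scale_pm)
  next
    case (single a d)
    show ?case by (simp add: scale_pm_single mult_single)
  next
    case (add p q)
    then show ?case
      by (simp add: vector_space_scale_pm[THEN vector_space.vector_space_assms(1)] distrib_left)
  qed
qed

interpretation pm: vector_space "scale_pm :: 'k::field \<Rightarrow> ('a \<Rightarrow>\<^sub>0 'k) \<Rightarrow> _"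
  by (rule vector_space_scale_pm)

text \<open>The scalar multiplication is an argument, so that one construction yields both the
  operators on the module and the action of the free algebra on an arbitrary space.\<close>

definition lin_ext ::
    "('a \<Rightarrow> 'b \<Rightarrow> 'b) \<Rightarrow> ('c \<Rightarrow> 'b) \<Rightarrow> ('c \<Rightarrow>\<^sub>0 'a::zero) \<Rightarrow> 'b::comm_monoid_add" where
  "lin_ext scl f p = (\<Sum>a\<in>Poly_Mapping.keys p. scl (Poly_Mapping.lookup p a) (f a))"

context vector_space
begin

text \<open>Cancellation may shrink the support of a sum; summing over a common finite superset
  turns additivity into a termwise computation.\<close>

lemma lin_ext_superset:
  fixes p :: "'c \<Rightarrow>\<^sub>0 'a"
  assumes "finite S" "Poly_Mapping.keys p \<subseteq> S"
  shows "lin_ext scale f p = (\<Sum>a\<in>S. scale (Poly_Mapping.lookup p a) (f a))"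
  unfolding lin_ext_def using assms
  by (intro sum.mono_neutral_left) (auto simp: in_keys_iff)

lemma lin_ext_zero [simp]: "lin_ext scale f 0 = 0"
  by (simp add: lin_ext_def)

lemma lin_ext_single [simp]: "lin_ext scale f (Poly_Mapping.single a c) = scale c (f a)"
  by (simp add: lin_ext_def)

lemma lin_ext_add: "lin_ext scale f (p + q) = lin_ext scale f p + lin_ext scale f q"
proof -
  let ?S = "Poly_Mapping.keys p \<union> Poly_Mapping.keys q"
  show ?thesis
    by (simp add: lin_ext_superset[of ?S] keys_add lookup_add scale_left_distrib sum.distrib)
qed

lemma lin_ext_scale: "lin_ext scale f (scale_pm c p) = scale c (lin_ext scale f p)"
  unfolding lin_ext_superset[OF finite_keys keys_scale_pm]
  by (simp add: lookup_scale_pm scale_sum_right lin_ext_def)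

lemma lin_ext_diff: "lin_ext scale f (p - q) = lin_ext scale f p - lin_ext scale f q"
  using lin_ext_add[of f "p - q" q] by simp

lemma lin_ext_in_subspace:
  assumes "subspace V" "\<And>a. a \<in> Poly_Mapping.keys p \<Longrightarrow> f a \<in> V"
  shows "lin_ext scale f p \<in> V"
  unfolding lin_ext_def using assms by (intro subspace_sum subspace_scale)

end


section \<open>The free algebra and its quotients\<close>

lemma words_plus: "u \<in> words n \<Longrightarrow> v \<in> words n \<Longrightarrow> u + v \<in> words n"
  by (auto simp: words_def plus_word_def)

lemma words_zero: "0 \<in> words n"
  by (auto simp: words_def zero_word_def)

lemma free_algebra_mult_closed:
  fixes p q :: "word \<Rightarrow>\<^sub>0 'k::field"
  assumes "Poly_Mapping.keys p \<subseteq> words n" "Poly_Mapping.keys q \<subseteq> words n"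
  shows "Poly_Mapping.keys (p * q) \<subseteq> words n"
  using keys_mult[of p q] words_plus assms by blast

lemma keys_add_subset:
  assumes "Poly_Mapping.keys p \<subseteq> S" "Poly_Mapping.keys q \<subseteq> S"
  shows "Poly_Mapping.keys (p + q) \<subseteq> S"
  using keys_add[of p q] assms by blast

lemma ring_free_algebra: "ring (free_algebra n :: ('k::field, _) module)"
proof (rule ringI)
  show "abelian_group (free_algebra n :: ('k, _) module)"
  proof (rule abelian_groupI)
    fix x :: "word \<Rightarrow>\<^sub>0 'k"
    assume "x \<in> carrier (free_algebra n)"
    then show "\<exists>y\<in>carrier (free_algebra n). y \<oplus>\<^bsub>free_algebra n\<^esub> x = \<zero>\<^bsub>free_algebra n\<^esub>"
      by (intro bexI[of _ "- x"]) (auto simp: free_algebra_def)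
  qed (auto simp: free_algebra_def add_ac dest: keys_add_subset[THEN subsetD, rotated 2])
  show "Group.monoid (free_algebra n :: ('k, _) module)"
    by (rule Group.monoidI)
      (auto simp: free_algebra_def mult.assoc words_zero
        dest: free_algebra_mult_closed[THEN subsetD, rotated 2])
qed (auto simp: free_algebra_def algebra_simps)

lemma mono_word_in_free_algebra:
  "set ls \<subseteq> Gen ` {1..n} \<union> Inv ` {1..n} \<Longrightarrow> mono_word ls \<in> carrier (free_algebra n)"
  by (auto simp: mono_word_def free_algebra_def words_def)

lemma scale_in_free_algebra:
  "p \<in> carrier (free_algebra n) \<Longrightarrow> scale_pm c p \<in> carrier (free_algebra n)"
  using keys_scale_pm[of c p] by (auto simp: free_algebra_def)

lemma diff_in_free_algebra:
  "p \<in> carrier (free_algebra n) \<Longrightarrow> q \<in> carrier (free_algebra n) \<Longrightarrow>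
   p - q \<in> carrier (free_algebra n)"
  using keys_diff[of p q] by (auto simp: free_algebra_def)

lemma one_in_free_algebra: "1 \<in> carrier (free_algebra n)"
  using words_zero by (auto simp: free_algebra_def)

lemma torus_relators_subset: "torus_relators n Q \<subseteq> carrier (free_algebra n)"
  unfolding torus_relators_def
  by (auto intro!: diff_in_free_algebra scale_in_free_algebra one_in_free_algebra
      mono_word_in_free_algebra)

lemma ideal_torus_ideal: "ideal (torus_ideal n Q) (free_algebra n)"
  unfolding torus_ideal_def
  by (rule ring.genideal_ideal[OF ring_free_algebra torus_relators_subset])

lemma torus_relators_subset_ideal: "torus_relators n Q \<subseteq> torus_ideal n Q"
  unfolding torus_ideal_def
  by (rule ring.genideal_self[OF ring_free_algebra torus_relators_subset])

section \<open>Computing with cosets of the torus ideal\<close>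

lemma free_algebra_simps:
  "monoid.mult (free_algebra n) = (*)" "\<one>\<^bsub>free_algebra n\<^esub> = 1"
  "add (free_algebra n) = (+)" "\<zero>\<^bsub>free_algebra n\<^esub> = 0"
  by (simp_all add: free_algebra_def)

lemma torus_class_eq_iff:
  assumes p: "p \<in> carrier (free_algebra n)" and q: "q \<in> carrier (free_algebra n)"
  shows "torus_class n Q p = torus_class n Q q \<longleftrightarrow> p - q \<in> torus_ideal n Q"
proof -
  interpret I: ideal "torus_ideal n Q" "free_algebra n" by (rule ideal_torus_ideal)
  have mem: "p \<in> torus_class n Q q \<longleftrightarrow> p - q \<in> torus_ideal n Q"
    unfolding torus_class_def a_r_coset_def'
    by (auto simp: free_algebra_simps intro!: bexI[of _ "p - q"])
  show ?thesis
    unfolding mem[symmetric] torus_class_def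
    using I.a_rcos_self[OF p] I.a_repr_independence'[OF _ q] by blast
qed

text \<open>Scalar multiplication in the quotient and \<open>torus_act\<close> both refer to members
  of a coset; this turns any member into a representative.\<close>

lemma torus_class_memD:
  assumes "q \<in> torus_class n Q p" "p \<in> carrier (free_algebra n)"
  shows "q \<in> carrier (free_algebra n)" "torus_class n Q q = torus_class n Q p"
proof -
  interpret I: ideal "torus_ideal n Q" "free_algebra n" by (rule ideal_torus_ideal)
  show "q \<in> carrier (free_algebra n)"
    using assms I.a_subset I.a_r_coset_subset_G[of "torus_ideal n Q" p]
    by (auto simp: torus_class_def)
  show "torus_class n Q q = torus_class n Q p"
    using assms I.a_repr_independence' unfolding torus_class_def by blast
qed

lemma torus_class_self: "p \<in> carrier (free_algebra n) \<Longrightarrow> p \<in> torus_class n Q p"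
proof -
  interpret I: ideal "torus_ideal n Q" "free_algebra n" by (rule ideal_torus_ideal)
  show "p \<in> carrier (free_algebra n) \<Longrightarrow> p \<in> torus_class n Q p"
    unfolding torus_class_def by (rule I.a_rcos_self)
qed

lemma carrier_quantum_torus:
  "carrier (quantum_torus n Q) = torus_class n Q ` carrier (free_algebra n)"
  by (auto simp: quantum_torus_def ring.defs FactRing_def A_RCOSETS_def' torus_class_def)

lemma torus_class_in_carrier:
  "p \<in> carrier (free_algebra n) \<Longrightarrow> torus_class n Q p \<in> carrier (quantum_torus n Q)"
  by (simp add: carrier_quantum_torus)

lemma quantum_torus_one: "\<one>\<^bsub>quantum_torus n Q\<^esub> = torus_class n Q 1"
  by (simp add: quantum_torus_def ring.defs FactRing_def torus_class_def free_algebra_simps)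

lemma quantum_torus_add:
  assumes "p \<in> carrier (free_algebra n)" "q \<in> carrier (free_algebra n)"
  shows "torus_class n Q p \<oplus>\<^bsub>quantum_torus n Q\<^esub> torus_class n Q q = torus_class n Q (p + q)"
proof -
  interpret I: ideal "torus_ideal n Q" "free_algebra n" by (rule ideal_torus_ideal)
  show ?thesis
    using I.a_rcos_sum[OF assms]
    by (simp add: quantum_torus_def ring.defs FactRing_def torus_class_def free_algebra_simps)
qed

lemma quantum_torus_mult:
  assumes "p \<in> carrier (free_algebra n)" "q \<in> carrier (free_algebra n)"
  shows "torus_class n Q p \<otimes>\<^bsub>quantum_torus n Q\<^esub> torus_class n Q q = torus_class n Q (p * q)"
proof -
  interpret I: ideal "torus_ideal n Q" "free_algebra n" by (rule ideal_torus_ideal)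
  show ?thesis
    using I.rcoset_mult_add[OF assms]
    by (simp add: quantum_torus_def ring.defs FactRing_def torus_class_def free_algebra_simps)
qed

text \<open>The union in the definition runs over all members \<open>q\<close> of the coset. It
  collapses to one coset because \<open>c\<close> times \<open>q - p\<close> stays in the
  ideal.\<close>

lemma quantum_torus_smult:
  assumes p: "p \<in> carrier (free_algebra n)"
  shows "c \<odot>\<^bsub>quantum_torus n Q\<^esub> torus_class n Q p = torus_class n Q (scale_pm c p)"
proof -
  interpret I: ideal "torus_ideal n Q" "free_algebra n" by (rule ideal_torus_ideal)
  have c: "Poly_Mapping.single 0 c \<in> carrier (free_algebra n)"
    using words_zero[of n] by (auto simp: free_algebra_def)
  have "torus_class n Q (scale_pm c q) = torus_class n Q (scale_pm c p)"
    if q: "q \<in> torus_class n Q p" for q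
  proof -
    note qD = torus_class_memD[OF q p]
    have "q - p \<in> torus_ideal n Q"
      using qD p torus_class_eq_iff by blast
    then have "Poly_Mapping.single 0 c * (q - p) \<in> torus_ideal n Q"
      using I.I_l_closed[OF _ c] by (simp add: free_algebra_simps)
    then have "scale_pm c q - scale_pm c p \<in> torus_ideal n Q"
      by (simp only: scale_pm_conv_mult right_diff_distrib)
    then show ?thesis
      using torus_class_eq_iff scale_in_free_algebra qD(1) p by blast
  qed
  moreover have "c \<odot>\<^bsub>quantum_torus n Q\<^esub> torus_class n Q p =
      (\<Union>q\<in>torus_class n Q p. torus_class n Q (scale_pm c q))"
    by (simp add: quantum_torus_def ring.defs module.defs)
  ultimately show ?thesis
    using torus_class_self[OF p, of Q] by blast
qed


section \<open>Modules from operators satisfying the torus relations\<close>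

text \<open>Right multiplication by a product applies its left factor first, hence the order of the
  operators in \<open>T_comm\<close>. Linearity is global, so that words act linearly without side
  conditions; the relations hold on \<open>V\<close> only, as for shifts modulo \<open>k i\<close>,
  which cancel only on reduced indices.\<close>

locale torus_operators = vector_space scl
  for scl :: "'k::field \<Rightarrow> 'v::ab_group_add \<Rightarrow> 'v" +
  fixes n :: nat and N :: "nat \<Rightarrow> nat \<Rightarrow> 'k" and V :: "'v set" and T :: "letter \<Rightarrow> 'v \<Rightarrow> 'v"
  assumes subspace_V: "subspace V"
    and T_add: "T l (u + v) = T l u + T l v"
    and T_scale: "T l (scl c v) = scl c (T l v)"
    and T_closed: "l \<in> Gen ` {1..n} \<union> Inv ` {1..n} \<Longrightarrow> v \<in> V \<Longrightarrow> T l v \<in> V"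
    and T_Gen_Inv: "i \<in> {1..n} \<Longrightarrow> v \<in> V \<Longrightarrow> T (Inv i) (T (Gen i) v) = v"
    and T_Inv_Gen: "i \<in> {1..n} \<Longrightarrow> v \<in> V \<Longrightarrow> T (Gen i) (T (Inv i) v) = v"
    and T_comm: "i \<in> {1..n} \<Longrightarrow> j \<in> {1..n} \<Longrightarrow> v \<in> V \<Longrightarrow>
      T (Gen j) (T (Gen i) v) = scl (N i j) (T (Gen i) (T (Gen j) v))"
begin

text \<open>\<open>fold\<close> reads the word from left to right, as a right action demands, so
  concatenation becomes composition without reversal.\<close>

definition word_act :: "'v \<Rightarrow> word \<Rightarrow> 'v" where
  "word_act v w = fold T (letters w) v"

definition free_act :: "'v \<Rightarrow> (word \<Rightarrow>\<^sub>0 'k) \<Rightarrow> 'v" where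
  "free_act v p = lin_ext scl (word_act v) p"

text \<open>The representative is arbitrary; \<open>torus_act_class\<close> shows that on
  \<open>V\<close> the choice does not matter.\<close>

definition torus_act :: "'v \<Rightarrow> (word \<Rightarrow>\<^sub>0 'k) set \<Rightarrow> 'v" where
  "torus_act v C = free_act v (SOME p. p \<in> C)"

lemma word_act_add: "word_act (u + v) w = word_act u w + word_act v w"
proof -
  have "fold T ls (u + v) = fold T ls u + fold T ls v" for ls
    by (induction ls arbitrary: u v) (simp_all add: T_add)
  then show ?thesis by (simp add: word_act_def)
qed

lemma word_act_scale: "word_act (scl c v) w = scl c (word_act v w)"
proof -
  have "fold T ls (scl c v) = scl c (fold T ls v)" for ls
    by (induction ls arbitrary: v) (simp_all add: T_scale)
  then show ?thesis by (simp add: word_act_def)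
qed

lemma word_act_closed:
  assumes "w \<in> words n" "v \<in> V"
  shows "word_act v w \<in> V"
proof -
  have "fold T ls v \<in> V" if "set ls \<subseteq> Gen ` {1..n} \<union> Inv ` {1..n}" for ls
    using that assms(2)
  proof (induction ls arbitrary: v)
    case (Cons l ls)
    then have "T l v \<in> V" by (intro T_closed) auto
    with Cons show ?case by simp
  qed simp
  then show ?thesis using assms(1) by (auto simp: word_act_def words_def)
qed

lemma word_act_plus: "word_act v (w + w') = word_act (word_act v w) w'"
  by (simp add: word_act_def plus_word_def)

lemma word_act_zero: "word_act v 0 = v"
  by (simp add: word_act_def zero_word_def)

lemma free_act_closed:
  "p \<in> carrier (free_algebra n) \<Longrightarrow> v \<in> V \<Longrightarrow> free_act v p \<in> V"
  unfolding free_act_def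
  by (rule lin_ext_in_subspace[OF subspace_V]) (auto simp: free_algebra_def intro: word_act_closed)

lemma free_act_add_left: "free_act (u + v) p = free_act u p + free_act v p"
  by (simp add: free_act_def lin_ext_def word_act_add scale_right_distrib sum.distrib)

lemma free_act_scale_left: "free_act (scl c v) p = scl c (free_act v p)"
  unfolding free_act_def lin_ext_def word_act_scale scale_sum_right
  by (rule sum.cong) (simp_all add: mult.commute)

lemma free_act_zero_left: "free_act 0 p = 0"
  using free_act_scale_left[of 0 0 p] by simp

lemma free_act_add: "free_act v (p + q) = free_act v p + free_act v q"
  by (simp add: free_act_def lin_ext_add)

lemma free_act_diff: "free_act v (p - q) = free_act v p - free_act v q"
  by (simp add: free_act_def lin_ext_diff)

lemma free_act_zero: "free_act v 0 = 0"
  by (simp add: free_act_def)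

lemma free_act_scale: "free_act v (scale_pm c p) = scl c (free_act v p)"
  by (simp add: free_act_def lin_ext_scale)

lemma free_act_single: "free_act v (Poly_Mapping.single w c) = scl c (word_act v w)"
  by (simp add: free_act_def)

lemma free_act_one: "free_act v 1 = v"
  using free_act_single[of v 0 1] by (simp add: word_act_zero)

lemma free_act_mono_word: "free_act v (mono_word ls) = fold T ls v"
  by (simp add: mono_word_def free_act_single word_act_def)

text \<open>Both sides are additive in \<open>p\<close> and in \<open>q\<close>, so two nested
  inductions reduce the claim to words, where it is \<open>word_act_plus\<close>.\<close>

lemma free_act_mult: "free_act v (p * q) = free_act (free_act v p) q"
proof -
  have "Poly_Mapping.keys p \<subseteq> UNIV" by simp
  then show ?thesis
  proof (induction p rule: poly_mapping_keys_induct)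
    case zero
    show ?case by (simp add: free_act_zero free_act_zero_left)
  next
    case (single w c)
    have "Poly_Mapping.keys q \<subseteq> UNIV" by simp
    then show ?case
      by (induction q rule: poly_mapping_keys_induct)
        (simp_all add: free_act_zero free_act_single mult_single word_act_plus word_act_scale
          distrib_left free_act_add mult.commute)
  next
    case (add p p')
    then show ?case by (simp add: distrib_right free_act_add free_act_add_left)
  qed
qed

text \<open>The annihilator of \<open>V\<close> is a two-sided ideal containing the relators, hence
  it contains the ideal they generate.\<close>

lemma free_act_torus_ideal:
  assumes p: "p \<in> torus_ideal n N" and v: "v \<in> V"
  shows "free_act v p = 0"
proof -
  \<comment> \<open>The quantifier over \<open>V\<close> is inside \<open>J\<close>: for
    \<open>x * a\<close> to kill \<open>v\<close>, the factor \<open>a\<close> has to kill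
    \<open>free_act v x\<close>.\<close>
  define J where "J = {p \<in> carrier (free_algebra n). \<forall>v\<in>V. free_act v p = 0}"
  have "ideal J (free_algebra n)"
  proof (rule idealI[OF ring_free_algebra])
    interpret ring "free_algebra n :: ('k, _) module" by (rule ring_free_algebra)
    show "subgroup J (add_monoid (free_algebra n))"
    proof (rule group.subgroupI)
      show "group (add_monoid (free_algebra n :: ('k, _) module))" by (rule a_group)
      show "J \<subseteq> carrier (add_monoid (free_algebra n))" by (auto simp: J_def)
      have "0 \<in> J" by (simp add: J_def free_algebra_def free_act_zero)
      then show "J \<noteq> {}" by blast
    next
      fix p assume "p \<in> J"
      then have p: "p \<in> carrier (free_algebra n)" and 0: "\<And>v. v \<in> V \<Longrightarrow> free_act v p = 0"
        by (auto simp: J_def)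
      have m: "- p \<in> carrier (free_algebra n)" using p by (simp add: free_algebra_def)
      have "\<ominus>\<^bsub>free_algebra n\<^esub> p = - p"
        by (rule minus_equality[OF _ p m]) (simp add: free_algebra_simps)
      moreover have "free_act v (- p) = 0" if "v \<in> V" for v
        using free_act_add[of v p "- p"] 0[OF that] by (simp add: free_act_zero)
      ultimately show "inv\<^bsub>add_monoid (free_algebra n)\<^esub> p \<in> J"
        using m by (simp add: a_inv_def J_def)
    next
      fix p r assume "p \<in> J" "r \<in> J"
      then show "p \<otimes>\<^bsub>add_monoid (free_algebra n)\<^esub> r \<in> J"
        by (simp add: J_def free_act_add free_algebra_def keys_add_subset)
    qed
  next
    fix a x :: "word \<Rightarrow>\<^sub>0 'k"
    assume "a \<in> J" "x \<in> carrier (free_algebra n)"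
    moreover from this have "x * a \<in> carrier (free_algebra n)" "a * x \<in> carrier (free_algebra n)"
      by (simp_all add: J_def free_algebra_def free_algebra_mult_closed)
    ultimately show "x \<otimes>\<^bsub>free_algebra n\<^esub> a \<in> J" "a \<otimes>\<^bsub>free_algebra n\<^esub> x \<in> J"
      by (auto simp: J_def free_algebra_simps free_act_mult free_act_closed free_act_zero_left)
  qed
  moreover have "torus_relators n N \<subseteq> J"
  proof -
    have "free_act v r = 0" if "r \<in> torus_relators n N" "v \<in> V" for r v
      using that(1) unfolding torus_relators_def
    proof (elim UnE CollectE exE conjE)
      fix i assume "r = mono_word [Gen i, Inv i] - 1" "i \<in> {1..n}"
      then show ?thesis
        using T_Gen_Inv[OF _ that(2), of i] by (simp add: free_act_diff free_act_one free_act_mono_word)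
    next
      fix i assume "r = mono_word [Inv i, Gen i] - 1" "i \<in> {1..n}"
      then show ?thesis
        using T_Inv_Gen[OF _ that(2), of i] by (simp add: free_act_diff free_act_one free_act_mono_word)
    next
      fix i j
      assume r: "r = mono_word [Gen i, Gen j] - scale_pm (N i j) (mono_word [Gen j, Gen i])"
        and ij: "i \<in> {1..n}" "j \<in> {1..n}"
      have "free_act v r = T (Gen j) (T (Gen i) v) - scl (N i j) (T (Gen i) (T (Gen j) v))"
        by (simp add: r free_act_diff free_act_scale free_act_mono_word)
      then show ?thesis unfolding T_comm[OF ij that(2)] by simp
    qed
    then show ?thesis using torus_relators_subset[of n N] by (auto simp: J_def)
  qed
  ultimately have "torus_ideal n N \<subseteq> J"
    unfolding torus_ideal_def by (rule ring.genideal_minimal[OF ring_free_algebra])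
  then show ?thesis using p v by (auto simp: J_def)
qed

text \<open>Two representatives differ by an element of the ideal, which acts as zero on
  \<open>V\<close>.\<close>

lemma torus_act_class:
  assumes v: "v \<in> V" and p: "p \<in> carrier (free_algebra n)"
  shows "torus_act v (torus_class n N p) = free_act v p"
proof -
  define r where "r = (SOME r. r \<in> torus_class n N p)"
  have "r \<in> torus_class n N p"
    unfolding r_def by (rule someI) (rule torus_class_self[OF p])
  from torus_class_memD[OF this p] p have "r - p \<in> torus_ideal n N"
    by (simp add: torus_class_eq_iff)
  then have "free_act v r = free_act v p"
    using free_act_torus_ideal[of "r - p", OF _ v] by (simp add: free_act_diff)
  then show ?thesis by (simp add: torus_act_def r_def)
qed

lemma torus_act_gen:
  assumes "v \<in> V" "i \<in> {1..n}"
  shows "torus_act v (torus_gen n N i) = T (Gen i) v"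
  using assms
  by (simp add: torus_gen_def torus_act_class mono_word_in_free_algebra free_act_mono_word)

lemma right_module_torus_act: "right_module (quantum_torus n N) scl V torus_act"
proof -
  have scl_V: "scl c v \<in> V" if "v \<in> V" for c v
    using that subspace_V by (rule subspace_scale[rotated])
  have add_V: "u + v \<in> V" if "u \<in> V" "v \<in> V" for u v
    using that subspace_add[OF subspace_V] by blast
  have F: "p + q \<in> carrier (free_algebra n)" "p * q \<in> carrier (free_algebra n)"
    if "p \<in> carrier (free_algebra n)" "q \<in> carrier (free_algebra n)" for p q :: "word \<Rightarrow>\<^sub>0 'k"
    using that by (simp_all add: free_algebra_def free_algebra_mult_closed keys_add_subset)
  show ?thesis
    unfolding right_module_def carrier_quantum_torus ball_simps
    using vector_space_axioms subspace_V
    by (simp add: quantum_torus_add quantum_torus_mult quantum_torus_smult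
        quantum_torus_one add_V scl_V F torus_act_class free_act_closed scale_in_free_algebra
        one_in_free_algebra free_act_add_left free_act_add free_act_mult free_act_one
        free_act_scale_left free_act_scale)
qed

text \<open>No condition on the action of the inverse letters is needed, since their classes are inverse
  to those of the generators.\<close>

lemma torus_act_unique:
  assumes mod: "right_module (quantum_torus n N) scl V act"
    and gen: "\<And>v i. v \<in> V \<Longrightarrow> i \<in> {1..n} \<Longrightarrow> act v (torus_gen n N i) = T (Gen i) v"
    and v: "v \<in> V" and x: "x \<in> carrier (quantum_torus n N)"
  shows "act v x = torus_act v x"
proof -
  let ?cl = "torus_class n N" and ?F = "carrier (free_algebra n) :: (word \<Rightarrow>\<^sub>0 'k) set"
  let ?L = "Gen ` {1..n} \<union> Inv ` {1..n}"
  have act_mult: "act v (?cl (p * q)) = act (act v (?cl p)) (?cl q)"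
    if "v \<in> V" "p \<in> ?F" "q \<in> ?F" for v p q
    using mod that quantum_torus_mult[of p n q N] torus_class_in_carrier
    unfolding right_module_def by metis
  have act_one: "act v (?cl 1) = v" if "v \<in> V" for v
    using mod that by (simp add: right_module_def quantum_torus_one)
  have act_add: "act v (?cl (p + q)) = act v (?cl p) + act v (?cl q)"
    if "v \<in> V" "p \<in> ?F" "q \<in> ?F" for v p q
    using mod that quantum_torus_add[of p n q N] torus_class_in_carrier
    unfolding right_module_def by metis
  have act_smult: "act v (?cl (scale_pm c p)) = scl c (act v (?cl p))"
    if "v \<in> V" "p \<in> ?F" for v c p
    using mod that quantum_torus_smult[of p n N c] torus_class_in_carrier
    unfolding right_module_def by metis
  have letter: "act v (?cl (mono_word [l])) = T l v" if l: "l \<in> ?L" and v: "v \<in> V" for l v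
  proof (cases l)
    case (Gen i)
    then show ?thesis using gen[OF v, of i] l by (auto simp: torus_gen_def)
  next
    case (Inv i)
    then have i: "i \<in> {1..n}" using l by auto
    \<comment> \<open>The generator maps \<open>u\<close> to \<open>v\<close>, so letting the
      inverse letter act on \<open>v\<close> amounts to acting on \<open>u\<close> by a product
      whose class is the unit.\<close>
    define u where "u = T (Inv i) v"
    have u: "u \<in> V" unfolding u_def using i v by (intro T_closed) auto
    have "act v (?cl (mono_word [l])) = act (act u (?cl (mono_word [Gen i]))) (?cl (mono_word [Inv i]))"
      using gen[OF u i] T_Inv_Gen[OF i v] Inv by (simp add: torus_gen_def u_def)
    also have "\<dots> = act u (?cl (mono_word [Gen i] * mono_word [Inv i]))"
      using u i by (simp add: act_mult mono_word_in_free_algebra)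
    also have "mono_word [Gen i] * mono_word [Inv i] = (mono_word [Gen i, Inv i] :: word \<Rightarrow>\<^sub>0 'k)"
      by (simp add: mono_word_def mult_single plus_word_def)
    also have "?cl (mono_word [Gen i, Inv i]) = ?cl 1"
      using torus_relators_subset_ideal[of n N] i
      by (subst torus_class_eq_iff)
        (auto simp: torus_relators_def one_in_free_algebra intro!: mono_word_in_free_algebra)
    also have "act u (?cl 1) = T l v"
      using act_one[OF u] Inv by (simp add: u_def)
    finally show ?thesis .
  qed
  have word: "act v (?cl (mono_word ls)) = fold T ls v" if "set ls \<subseteq> ?L" "v \<in> V" for ls v
    using that
  proof (induction ls arbitrary: v)
    case Nil
    have "mono_word [] = (1 :: word \<Rightarrow>\<^sub>0 'k)"
      by (simp add: mono_word_def zero_word_def[symmetric])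
    then show ?case using act_one Nil by simp
  next
    case (Cons l ls)
    have "mono_word (l # ls) = mono_word [l] * (mono_word ls :: word \<Rightarrow>\<^sub>0 'k)"
      by (simp add: mono_word_def mult_single plus_word_def)
    moreover have "mono_word [l] \<in> ?F" "mono_word ls \<in> ?F"
      using Cons.prems by (auto intro!: mono_word_in_free_algebra)
    ultimately show ?case
      using Cons by (simp add: act_mult letter T_closed)
  qed
  obtain p where p: "p \<in> ?F" and xp: "x = ?cl p"
    using x by (auto simp: carrier_quantum_torus)
  from p have "Poly_Mapping.keys p \<subseteq> words n" by (simp add: free_algebra_def)
  then have "act v (?cl p) = free_act v p"
  proof (induction p rule: poly_mapping_keys_induct)
    case zero
    \<comment> \<open>The zero class is reached as 0 times the unit, where compatibility with
      scalars gives its action.\<close>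
    have "act v (?cl (scale_pm 0 1)) = 0"
      using act_smult[OF v one_in_free_algebra, of 0] by simp
    then show ?case by (simp add: free_act_zero)
  next
    case (single w c)
    then have w: "set (letters w) \<subseteq> ?L" by (simp add: words_def)
    have "Poly_Mapping.single w c = scale_pm c (mono_word (letters w))"
      by (simp add: scale_pm_single mono_word_def)
    then show ?case
      using act_smult[OF v mono_word_in_free_algebra[OF w], of c] word[OF w v]
      by (simp add: free_act_scale free_act_mono_word)
  next
    case (add p q)
    then show ?case using act_add[OF v] by (simp add: free_act_add free_algebra_def)
  qed
  then show ?thesis using v p by (simp add: xp torus_act_class)
qed

end


section \<open>The operators on \<open>M(\<alpha>)\<close>\<close>

text \<open>This absorbs the reduction of indices modulo \<open>k i\<close> when an index wraps
  around.\<close>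

lemma power_int_mod:
  fixes z :: "'k::field"
  assumes "z \<noteq> 0" "z ^ r = 1"
  shows "z powi (x mod int r) = z powi x"
proof -
  have "z powi x = z powi (int r * (x div int r) + x mod int r)" by simp
  also have "\<dots> = (z powi int r) powi (x div int r) * z powi (x mod int r)"
    using assms(1) by (subst power_int_add) (simp_all add: power_int_mult)
  also have "\<dots> = z powi (x mod int r)"
    using assms(2) by simp
  finally show ?thesis ..
qed

lemma shift_shift:
  assumes "0 < k i"
  shows "shift k i d (shift k i e a) = shift k i (e + d) a"
  using assms by (simp add: shift_def mod_add_left_eq add.assoc)

lemma shift_zero: "a i < k i \<Longrightarrow> shift k i 0 a = a"
  by (simp add: shift_def)

lemma shift_in_M_index:
  assumes "a \<in> M_index s k" "i \<in> {1..s}" "0 < k i"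
  shows "shift k i d a \<in> M_index s k"
  using assms by (auto simp: M_index_def shift_def PiE_iff extensional_def nat_less_iff)

text \<open>\<open>root\<close> and \<open>primitive\<close> together say that
  \<open>q ^ h i\<close> has order exactly \<open>k i\<close>. The first yields the commutation
  relations, the second simplicity.\<close>

locale M_operators =
  fixes n s :: nat and q :: "'k::field" and h k :: "nat \<Rightarrow> nat" and \<alpha> :: "nat \<Rightarrow> 'k"
  assumes s: "2 * s \<le> n"
    and q_nonzero: "q \<noteq> 0"
    and k_pos: "i \<in> {1..s} \<Longrightarrow> 0 < k i"
    and root: "i \<in> {1..s} \<Longrightarrow> (q ^ h i) ^ k i = 1"
    and primitive: "i \<in> {1..s} \<Longrightarrow> inj_on (\<lambda>x. (q ^ h i) ^ x) {0..<k i}"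
    and \<alpha>_nonzero: "i \<in> {1..n} \<Longrightarrow> \<alpha> i \<noteq> 0"
begin

text \<open>With \<open>d = 1\<close> this is the effect of the generator \<open>j\<close> on
  indices, with \<open>d = - 1\<close> that of its inverse. The partner \<open>i + s\<close> moves
  index \<open>i\<close> the opposite way, hence \<open>- d\<close>.\<close>

definition gen_shift :: "nat \<Rightarrow> int \<Rightarrow> (nat \<Rightarrow> nat) \<Rightarrow> nat \<Rightarrow> nat" where
  "gen_shift j d a =
     (if j \<in> {1..s} then shift k j d a
      else if j \<in> {s + 1..2 * s} then shift k (j - s) (- d) a
      else a)"

text \<open>The exponent is -1 when the index is 0, hence \<open>powi\<close>.\<close>

definition gen_coeff :: "nat \<Rightarrow> (nat \<Rightarrow> nat) \<Rightarrow> 'k" where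
  "gen_coeff j a =
     (if j \<in> {s + 1..2 * s}
      then inverse (\<alpha> (j - s)) * \<alpha> j * (q ^ h (j - s)) powi (int (a (j - s)) - 1)
      else \<alpha> j)"

text \<open>The inverse operator divides by the coefficient at the index
  \<open>gen_shift j (- 1) a\<close>, from which the generator leads to \<open>a\<close>.\<close>

definition M_op :: "letter \<Rightarrow> ((nat \<Rightarrow> nat) \<Rightarrow>\<^sub>0 'k) \<Rightarrow> ((nat \<Rightarrow> nat) \<Rightarrow>\<^sub>0 'k)" where
  "M_op l = lin_ext scale_pm (\<lambda>a. case l of
     Gen j \<Rightarrow> Poly_Mapping.single (gen_shift j 1 a) (gen_coeff j a)
   | Inv j \<Rightarrow> Poly_Mapping.single (gen_shift j (- 1) a) (inverse (gen_coeff j (gen_shift j (- 1) a))))"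

lemma M_op_Gen_single:
  "M_op (Gen j) (Poly_Mapping.single a c) =
     Poly_Mapping.single (gen_shift j 1 a) (c * gen_coeff j a)"
  by (simp add: M_op_def pm.lin_ext_single scale_pm_single)

lemma M_op_Inv_single:
  "M_op (Inv j) (Poly_Mapping.single a c) =
     Poly_Mapping.single (gen_shift j (- 1) a) (c * inverse (gen_coeff j (gen_shift j (- 1) a)))"
  by (simp add: M_op_def pm.lin_ext_single scale_pm_single)

lemma M_op_add: "M_op l (u + v) = M_op l u + M_op l v"
  by (simp add: M_op_def pm.lin_ext_add)

lemma M_op_scale: "M_op l (scale_pm c v) = scale_pm c (M_op l v)"
  by (simp add: M_op_def pm.lin_ext_scale)

lemma M_op_zero: "M_op l 0 = 0"
  by (simp add: M_op_def)

lemma partner: "j \<in> {s + 1..2 * s} \<Longrightarrow> j - s \<in> {1..s}"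
  by auto

lemma gen_shift_in_M_index:
  assumes "a \<in> M_index s k"
  shows "gen_shift j d a \<in> M_index s k"
proof -
  consider "j \<in> {1..s}" | "j \<in> {s + 1..2 * s}" "j \<notin> {1..s}" | "j \<notin> {1..s}" "j \<notin> {s + 1..2 * s}"
    by blast
  then show ?thesis
    by cases (simp_all only: gen_shift_def if_True if_False shift_in_M_index assms k_pos partner)
qed

lemma M_index_less: "a \<in> M_index s k \<Longrightarrow> i \<in> {1..s} \<Longrightarrow> a i < k i"
  by (auto simp: M_index_def PiE_iff)

text \<open>Shifts return reduced values, so opposite shifts restore an index only if it was reduced
  already; membership in \<open>M_index\<close> ensures this.\<close>

lemma gen_shift_cancel:
  assumes a: "a \<in> M_index s k" and "d + e = 0"
  shows "gen_shift j d (gen_shift j e a) = a"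
proof -
  have *: "shift k i d' (shift k i e' a) = a" if "i \<in> {1..s}" "e' + d' = 0" for i d' e'
    using that k_pos[of i] M_index_less[OF a, of i] by (simp add: shift_shift shift_zero)
  show ?thesis
    using assms(2) *[of j e d] *[OF partner, of j "- e" "- d"] by (auto simp: gen_shift_def)
qed

lemma shift_commute:
  assumes "i \<in> {1..s}" "j \<in> {1..s}"
  shows "shift k i d (shift k j e a) = shift k j e (shift k i d a)"
proof (cases "i = j")
  case True
  then show ?thesis using assms k_pos by (simp add: shift_shift add.commute)
next
  case False
  then show ?thesis by (simp add: shift_def fun_upd_twist)
qed

text \<open>Every generator moves one coordinate or none, so commutation of the shifts comes down to
  \<open>shift_commute\<close>.\<close>

lemma gen_shift_cases:
  obtains i' d' where "i' \<in> {1..s}" "gen_shift i d = shift k i' d'" | "gen_shift i d = (\<lambda>a. a)"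
proof -
  consider "i \<in> {1..s}" | "i \<in> {s + 1..2 * s}" "i \<notin> {1..s}" | "i \<notin> {1..s}" "i \<notin> {s + 1..2 * s}"
    by blast
  then show ?thesis
  proof cases
    case 1
    then show ?thesis by (intro that(1)[of i d]) (simp_all add: gen_shift_def fun_eq_iff)
  next
    case 2
    then show ?thesis
      by (intro that(1)[OF partner, of i "- d"]) (simp_all only: gen_shift_def fun_eq_iff if_True if_False simp_thms)
  next
    case 3
    show ?thesis by (rule that(2), rule ext) (simp only: gen_shift_def if_False 3)
  qed
qed

lemma gen_shift_commute: "gen_shift i d (gen_shift j e a) = gen_shift j e (gen_shift i d a)"
proof (cases rule: gen_shift_cases[of i d])
  case i: (1 i' d')
  show ?thesis
  proof (cases rule: gen_shift_cases[of j e])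
    case (1 j' e')
    then show ?thesis by (simp only: i shift_commute)
  qed (simp only: i)
qed (simp only:)

lemma gen_coeff_nonzero: "j \<in> {1..n} \<Longrightarrow> gen_coeff j a \<noteq> 0"
  using q_nonzero \<alpha>_nonzero[of j] \<alpha>_nonzero[of "j - s"] partner[of j] s
  by (auto simp: gen_coeff_def)

text \<open>\<open>gen_coeff j\<close> depends at most on index \<open>j - s\<close>, which only the
  generators \<open>j - s\<close> and \<open>j\<close> move; the assumptions exclude both.\<close>

lemma gen_coeff_shift_other:
  assumes "i \<noteq> j" "\<not> (i \<in> {1..s} \<and> j = i + s)"
  shows "gen_coeff j (gen_shift i d a) = gen_coeff j a"
proof (cases "j \<in> {s + 1..2 * s}")
  case True
  have "gen_shift i d a (j - s) = a (j - s)"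
  proof (cases rule: linorder_le_cases[of i s])
    case le
    then have "j - s \<noteq> i" if "i \<in> {1..s}" using assms True that by auto
    with le show ?thesis by (auto simp: gen_shift_def shift_def)
  next
    case ge
    then have "j - s \<noteq> i - s" using assms(1) True by auto
    with ge assms(2) True show ?thesis by (auto simp: gen_shift_def shift_def)
  qed
  then show ?thesis by (simp only: gen_coeff_def)
next
  case False
  then show ?thesis by (simp only: gen_coeff_def if_False)
qed

text \<open>Raising index \<open>i\<close> by one raises the exponent of \<open>q ^ h i\<close> by
  one. At the wrap from \<open>k i - 1\<close> to 0 this remains true since \<open>q ^ h i\<close>
  is a \<open>k i\<close>-th root of unity.\<close>

lemma gen_coeff_shift_paired:
  assumes i: "i \<in> {1..s}"
  shows "gen_coeff (i + s) (gen_shift i 1 a) = q ^ h i * gen_coeff (i + s) a"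
proof -
  define z where "z = q ^ h i"
  have z: "z \<noteq> 0" using q_nonzero by (simp add: z_def)
  have zk: "z ^ k i = 1" using root[OF i] by (simp add: z_def)
  define b where "b = gen_shift i 1 a"
  have "int (b i) = (int (a i) + 1) mod int (k i)"
    using i k_pos[OF i] by (simp add: b_def gen_shift_def shift_def)
  then have "z powi int (b i) = z powi (int (a i) + 1)"
    by (simp only: power_int_mod[OF z zk])
  moreover have "z powi (int (b i) - 1) = z powi int (b i) / z"
    using z by (simp add: power_int_diff)
  ultimately have "z powi (int (b i) - 1) = z powi (int (a i) + 1) / z" by simp
  also have "\<dots> = z * z powi (int (a i) - 1)"
    using z by (simp add: power_int_add power_int_diff)
  finally have "z powi (int (b i) - 1) = z * z powi (int (a i) - 1)" .
  moreover have "gen_coeff (i + s) c = inverse (\<alpha> i) * \<alpha> (i + s) * z powi (int (c i) - 1)" for c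
    using i by (simp add: gen_coeff_def z_def)
  ultimately show ?thesis
    unfolding b_def[symmetric] z_def[symmetric] by (simp only: mult_ac)
qed

section \<open>Verification of the torus relations\<close>

lemma M_space_subspace: "pm.subspace (M_space s k :: ((nat \<Rightarrow> nat) \<Rightarrow>\<^sub>0 'k) set)"
proof (rule pm.subspaceI)
  fix c and v :: "(nat \<Rightarrow> nat) \<Rightarrow>\<^sub>0 'k"
  assume "v \<in> M_space s k"
  then show "scale_pm c v \<in> M_space s k"
    using keys_scale_pm[of c v] by (auto simp: M_space_def)
qed (simp_all add: M_space_def keys_add_subset)

lemma single_in_M_space: "a \<in> M_index s k \<Longrightarrow> Poly_Mapping.single a c \<in> M_space s k"
  by (simp add: M_space_def)

lemma M_space_induct [consumes 1, case_names zero single add]: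
  assumes v: "v \<in> M_space s k"
    and P: "P 0" "\<And>a c. a \<in> M_index s k \<Longrightarrow> P (Poly_Mapping.single a c)"
      "\<And>u v. u \<in> M_space s k \<Longrightarrow> v \<in> M_space s k \<Longrightarrow> P u \<Longrightarrow> P v \<Longrightarrow> P (u + v)"
  shows "P v"
proof -
  have "Poly_Mapping.keys v \<subseteq> M_index s k" using v by (simp add: M_space_def)
  then show ?thesis
    by (induction v rule: poly_mapping_keys_induct) (auto intro: P simp: M_space_def)
qed

lemma M_op_closed: "v \<in> M_space s k \<Longrightarrow> M_op l v \<in> M_space s k"
  by (induction v rule: M_space_induct; cases l)
    (simp_all add: M_op_zero M_op_add M_op_Gen_single M_op_Inv_single single_in_M_space
      gen_shift_in_M_index pm.subspace_add[OF M_space_subspace] pm.subspace_0[OF M_space_subspace])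

lemma M_op_cancel:
  assumes "i \<in> {1..n}" "v \<in> M_space s k"
  shows "M_op (Inv i) (M_op (Gen i) v) = v" "M_op (Gen i) (M_op (Inv i) v) = v"
  using assms(2)
  by (induction v rule: M_space_induct)
    (simp_all add: M_op_zero M_op_add M_op_Gen_single M_op_Inv_single gen_shift_cancel
      gen_coeff_nonzero[OF assms(1)] mult.assoc)

text \<open>This is the commutation relation on a basis vector, with the common target index
  removed. Only partners contribute a factor: \<open>q ^ h i\<close> in one order, an inverse power
  in the other.\<close>

lemma gen_coeff_commute:
  assumes ij: "i \<in> {1..n}" "j \<in> {1..n}"
  shows "gen_coeff i a * gen_coeff j (gen_shift i 1 a) =
    normal_matrix q s h i j * (gen_coeff j a * gen_coeff i (gen_shift j 1 a))"
proof -
  consider "i = j" | "i \<noteq> j" "i \<in> {1..s}" "j = i + s" | "i \<noteq> j" "j \<in> {1..s}" "i = j + s"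
    | "i \<noteq> j" "\<not> (i \<in> {1..s} \<and> j = i + s)" "\<not> (j \<in> {1..s} \<and> i = j + s)"
    by blast
  then show ?thesis
  proof cases
    case 1
    then show ?thesis by (auto simp: normal_matrix_def)
  next
    case 2
    then have "gen_coeff i (gen_shift j 1 a) = gen_coeff i a"
      by (intro gen_coeff_shift_other) auto
    then show ?thesis
      using 2 gen_coeff_shift_paired[of i a] by (simp add: normal_matrix_def)
  next
    case 3
    then have "gen_coeff j (gen_shift i 1 a) = gen_coeff j a"
      by (intro gen_coeff_shift_other) auto
    then show ?thesis
      using 3 gen_coeff_shift_paired[of j a] q_nonzero by (simp add: normal_matrix_def)
  next
    case 4
    then have "normal_matrix q s h i j = 1" by (auto simp: normal_matrix_def)
    then show ?thesis using 4 by (simp add: gen_coeff_shift_other)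
  qed
qed

lemma M_op_comm:
  assumes ij: "i \<in> {1..n}" "j \<in> {1..n}" and v: "v \<in> M_space s k"
  shows "M_op (Gen j) (M_op (Gen i) v) =
    scale_pm (normal_matrix q s h i j) (M_op (Gen i) (M_op (Gen j) v))"
  using v
proof (induction v rule: M_space_induct)
  case (single a c)
  show ?case
    using gen_coeff_commute[OF ij, of a]
    by (simp add: M_op_Gen_single scale_pm_single gen_shift_commute[of j 1 i 1] mult_ac)
qed (simp_all add: M_op_zero M_op_add pm.scale_right_distrib)

text \<open>From here on \<open>torus_act\<close> makes the space a right module over the torus of
  \<open>normal_matrix q s h\<close>.\<close>

sublocale torus_operators scale_pm n "normal_matrix q s h" "M_space s k" M_op
  by unfold_locales
    (rule M_space_subspace M_op_add M_op_scale M_op_closed M_op_cancel M_op_comm; assumption)+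

text \<open>In the last clause \<open>1 \<le> j\<close> keeps away from the generator
  \<open>2 * s\<close>, which for positive \<open>s\<close> still shifts an index.\<close>

lemma M_op_on_basis:
  assumes a: "a \<in> M_index s k"
  shows "i \<in> {1..s} \<Longrightarrow>
      M_op (Gen i) (basis_vec a) = scale_pm (\<alpha> i) (basis_vec (shift k i 1 a))"
    and "i \<in> {1..s} \<Longrightarrow> M_op (Gen (i + s)) (basis_vec a) =
      scale_pm (inverse (\<alpha> i) * \<alpha> (i + s) * (q ^ h i) powi (int (a i) - 1))
        (basis_vec (shift k i (- 1) a))"
    and "1 \<le> j \<Longrightarrow> M_op (Gen (2 * s + j)) (basis_vec a) = scale_pm (\<alpha> (2 * s + j)) (basis_vec a)"
  by (auto simp: basis_vec_def M_op_Gen_single scale_pm_single gen_coeff_def gen_shift_def)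

text \<open>This serves uniqueness. Linearity is asked for on \<open>M_space s k\<close> only,
  because the module axioms constrain a competing action only there.\<close>

lemma M_op_determined:
  fixes T :: "nat \<Rightarrow> ((nat \<Rightarrow> nat) \<Rightarrow>\<^sub>0 'k) \<Rightarrow> ((nat \<Rightarrow> nat) \<Rightarrow>\<^sub>0 'k)"
  assumes add: "\<And>u v. u \<in> M_space s k \<Longrightarrow> v \<in> M_space s k \<Longrightarrow> T i (u + v) = T i u + T i v"
    and scale: "\<And>c v. v \<in> M_space s k \<Longrightarrow> T i (scale_pm c v) = scale_pm c (T i v)"
    and basis: "\<And>a. a \<in> M_index s k \<Longrightarrow> T i (basis_vec a) = M_op (Gen i) (basis_vec a)"
    and v: "v \<in> M_space s k"
  shows "T i v = M_op (Gen i) v"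
  using v
proof (induction v rule: M_space_induct)
  case zero
  show ?case using scale[of 0 0] M_space_subspace by (simp add: M_op_zero pm.subspace_0)
next
  case (single a c)
  have "Poly_Mapping.single a c = scale_pm c (basis_vec a)"
    by (simp add: basis_vec_def scale_pm_single)
  then show ?case
    using basis[OF single] scale[of "basis_vec a" c] single_in_M_space[OF single, of 1]
    by (simp add: M_op_scale basis_vec_def)
qed (simp_all add: add M_op_add)


section \<open>Simplicity and dimension\<close>

text \<open>\<open>X\<^sub>i X\<^sub>i\<^sub>+\<^sub>s\<close> acts diagonally, and its eigenvalue separates the possible values of
  the \<open>i\<close>-th index.\<close>

lemma lookup_M_op_pair:
  assumes i: "i \<in> {1..s}" and v: "v \<in> M_space s k"
  shows "Poly_Mapping.lookup (M_op (Gen (i + s)) (M_op (Gen i) v)) a =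
    \<alpha> (i + s) * (q ^ h i) ^ a i * Poly_Mapping.lookup v a"
  using v
proof (induction v rule: M_space_induct)
  case (single b c)
  have "gen_shift (i + s) 1 (gen_shift i 1 b) = b"
    using i k_pos[OF i] M_index_less[OF single i]
    by (simp add: gen_shift_def shift_shift shift_zero)
  \<comment> \<open>\<open>\<alpha> i\<close> cancels its inverse, and the factor
    \<open>q ^ h i\<close> gained by the shift makes up for the -1 in the exponent.\<close>
  moreover have "gen_coeff i b * gen_coeff (i + s) (gen_shift i 1 b) = \<alpha> (i + s) * (q ^ h i) ^ b i"
    using i q_nonzero \<alpha>_nonzero[of i] s
    by (simp add: gen_coeff_shift_paired) (simp add: gen_coeff_def power_int_diff)
  ultimately show ?case
    by (simp add: M_op_Gen_single lookup_single when_def mult_ac)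
qed (simp_all add: M_op_zero M_op_add lookup_add distrib_left)

text \<open>Descent on the size of the support: as long as two basis vectors occur in
  \<open>w\<close>, a nonzero element of \<open>W\<close> with smaller support can be built.\<close>

lemma submodule_contains_basis_vec:
  assumes W: "pm.subspace W" "W \<subseteq> M_space s k"
    and closed: "\<And>i v. i \<in> {1..2 * s} \<Longrightarrow> v \<in> W \<Longrightarrow> M_op (Gen i) v \<in> W"
    and w: "w \<in> W" "w \<noteq> 0"
  shows "\<exists>a\<in>M_index s k. basis_vec a \<in> W"
  using w
proof (induction "card (Poly_Mapping.keys w)" arbitrary: w rule: less_induct)
  case less
  have wM: "w \<in> M_space s k" using less.prems W by auto
  obtain a where a: "a \<in> Poly_Mapping.keys w" using less.prems(2) by (metis ex_in_conv keys_eq_empty)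
  show ?case
  proof (cases "Poly_Mapping.keys w = {a}")
    case True
    let ?c = "Poly_Mapping.lookup w a"
    have "w = Poly_Mapping.single a ?c"
      using poly_mapping_sum_singles[of w] True by simp
    moreover have "?c \<noteq> 0" using a by (simp add: in_keys_iff)
    ultimately have "basis_vec a = scale_pm (inverse ?c) w"
      by (metis basis_vec_def left_inverse scale_pm_single)
    then have "basis_vec a \<in> W" using pm.subspace_scale[OF W(1) less.prems(1)] by simp
    then show ?thesis using a wM by (auto simp: M_space_def)
  next
    case False
    then obtain b where b: "b \<in> Poly_Mapping.keys w" "b \<noteq> a" using a by blast
    have ab: "a \<in> M_index s k" "b \<in> M_index s k" using a b wM by (auto simp: M_space_def)
    obtain i where i: "i \<in> {1..s}" "b i \<noteq> a i"
      using PiE_ext[of b "{1..s}" "\<lambda>i. {0..<k i}" a] ab b(2) unfolding M_index_def by blast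
    let ?z = "q ^ h i"
    \<comment> \<open>Subtracting the eigenvalue at \<open>a\<close> removes \<open>a\<close> from
      the support, while \<open>b\<close> survives because \<open>primitive\<close> makes the
      eigenvalues at \<open>a\<close> and \<open>b\<close> different.\<close>
    define u where "u = M_op (Gen (i + s)) (M_op (Gen i) w) - scale_pm (\<alpha> (i + s) * ?z ^ a i) w"
    have u: "Poly_Mapping.lookup u c = \<alpha> (i + s) * (?z ^ c i - ?z ^ a i) * Poly_Mapping.lookup w c" for c
      using lookup_M_op_pair[OF i(1) wM]
      by (simp add: u_def lookup_minus lookup_scale_pm algebra_simps)
    have "u \<in> W"
      unfolding u_def using i(1) less.prems(1)
      by (intro pm.subspace_diff[OF W(1)] pm.subspace_scale[OF W(1)] closed) auto
    have "?z ^ b i \<noteq> ?z ^ a i"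
      using inj_on_contraD[OF primitive[OF i(1)] i(2)] M_index_less[OF ab(1) i(1)]
        M_index_less[OF ab(2) i(1)] by simp
    then have "Poly_Mapping.lookup u b \<noteq> 0"
      using b(1) i(1) s \<alpha>_nonzero[of "i + s"] by (simp add: u in_keys_iff)
    then have "u \<noteq> 0" by auto
    have "Poly_Mapping.keys u \<subset> Poly_Mapping.keys w"
      using a by (auto simp: in_keys_iff u)
    then have "card (Poly_Mapping.keys u) < card (Poly_Mapping.keys w)"
      by (intro psubset_card_mono) auto
    from less.hyps[OF this \<open>u \<in> W\<close> \<open>u \<noteq> 0\<close>] show ?thesis .
  qed
qed

text \<open>Starting from one basis vector in \<open>W\<close>, the first \<open>s\<close>
  generators reach all the others, up to nonzero scalars that are divided out.\<close>

lemma submodule_trivial: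
  assumes W: "pm.subspace W" "W \<subseteq> M_space s k"
    and closed: "\<And>i v. i \<in> {1..2 * s} \<Longrightarrow> v \<in> W \<Longrightarrow> M_op (Gen i) v \<in> W"
  shows "W = {0} \<or> W = M_space s k"
proof (cases "W = {0}")
  case False
  then obtain w where "w \<in> W" "w \<noteq> 0" using pm.subspace_0[OF W(1)] by blast
  then obtain a where a: "a \<in> M_index s k" "basis_vec a \<in> W"
    using submodule_contains_basis_vec[OF W closed] by blast
  have shift: "basis_vec (shift k i (int d) c) \<in> W"
    if i: "i \<in> {1..s}" and c: "c \<in> M_index s k" "basis_vec c \<in> W" for i d c
  proof (induction d)
    case 0
    then show ?case using c M_index_less[OF c(1) i] by (simp add: shift_zero)
  next
    case (Suc d)
    let ?c = "shift k i (int d) c"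
    have "?c \<in> M_index s k" using shift_in_M_index c(1) i k_pos by blast
    then have "scale_pm (\<alpha> i) (basis_vec (shift k i 1 ?c)) \<in> W"
      using closed[OF _ Suc, of i] M_op_on_basis(1)[of ?c i] i by simp
    then have "scale_pm (inverse (\<alpha> i)) (scale_pm (\<alpha> i) (basis_vec (shift k i 1 ?c))) \<in> W"
      by (rule pm.subspace_scale[OF W(1)])
    then show ?case
      using \<alpha>_nonzero[of i] i s k_pos[OF i] by (simp add: shift_shift add.commute)
  qed
  have upd: "basis_vec (c(i := x)) \<in> W"
    if i: "i \<in> {1..s}" and c: "c \<in> M_index s k" "basis_vec c \<in> W" and x: "x < k i" for i x c
  proof -
    have lt: "c i < k i" using M_index_less[OF c(1) i] .
    \<comment> \<open>The number of steps \<open>x + k i - c i\<close> represents the difference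
      \<open>x - c i\<close> modulo \<open>k i\<close> by a natural number.\<close>
    then have "(int (c i) + int (x + k i - c i)) mod int (k i) = (int x + int (k i)) mod int (k i)"
      by (intro arg_cong[of _ _ "\<lambda>y. y mod int (k i)"]) simp
    also have "\<dots> = int x" using x by simp
    finally show ?thesis
      using shift[OF i c, of "x + k i - c i"] by (simp add: shift_def)
  qed
  have all: "basis_vec b \<in> W" if b: "b \<in> M_index s k" for b
  proof -
    \<comment> \<open>\<open>c t\<close> interpolates between \<open>a\<close> and \<open>b\<close>,
      so that consecutive indices differ in at most one coordinate.\<close>
    define c where "c t = (\<lambda>i. if i \<le> t then b i else a i)" for t
    have cM: "c t \<in> M_index s k" for t
      using a(1) b by (auto simp: c_def M_index_def PiE_iff extensional_def)
    have "basis_vec (c t) \<in> W" if "t \<le> s" for t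
      using that
    proof (induction t)
      case 0
      \<comment> \<open>Coordinate 0 lies outside \<open>{1..s}\<close>, where all members of
        \<open>M_index\<close> take the value \<open>undefined\<close>.\<close>
      have "b 0 = a 0"
        using a(1) b by (auto simp: M_index_def PiE_iff extensional_def)
      then have "c 0 = a" by (auto simp: c_def)
      then show ?case using a(2) by simp
    next
      case (Suc t)
      then have "basis_vec ((c t)(Suc t := b (Suc t))) \<in> W"
        using M_index_less[OF b, of "Suc t"] by (intro upd cM) auto
      moreover have "(c t)(Suc t := b (Suc t)) = c (Suc t)" by (auto simp: c_def)
      ultimately show ?case by simp
    qed
    moreover have "c s = b"
      using a(1) b by (auto simp: c_def M_index_def PiE_iff extensional_def fun_eq_iff)
    ultimately show ?thesis by (metis order_refl)
  qed
  have "v \<in> W" if "v \<in> M_space s k" for v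
    using that
  proof (induction v rule: M_space_induct)
    case (single b c)
    then show ?case
      using pm.subspace_scale[OF W(1) all[OF single], of c] by (simp add: basis_vec_def scale_pm_single)
  qed (use W in \<open>auto intro: pm.subspace_0 pm.subspace_add\<close>)
  then show ?thesis using W(2) by blast
qed simp

section \<open>Basis and dimension\<close>

lemma card_M_index: "card (M_index s k) = (\<Prod>i = 1..s. k i)"
  by (simp add: M_index_def card_PiE)

lemma finite_M_index: "finite (M_index s k)"
  by (auto simp: M_index_def intro: finite_PiE)

lemma M_index_nonempty: "M_index s k \<noteq> {}"
  using k_pos by (force simp: M_index_def PiE_eq_empty_iff)

lemma dim_M_space:
  "pm.dim (M_space s k :: ((nat \<Rightarrow> nat) \<Rightarrow>\<^sub>0 'k) set) = (\<Prod>i = 1..s. k i)"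
proof -
  let ?b = "basis_vec :: _ \<Rightarrow> _ \<Rightarrow>\<^sub>0 'k"
  let ?B = "?b ` M_index s k"
  \<comment> \<open>As 1 is not 0 in a field, the support of a basis vector recovers its
    index.\<close>
  have inj: "inj_on ?b A" for A
    by (rule inj_onI) (metis basis_vec_def keys_single singleton_iff zero_neq_one singleton_inject)
  have "\<not> pm.dependent ?B"
  proof (rule pm.independent_if_scalars_zero)
    show "finite ?B" using finite_M_index by simp
    fix f x assume sum: "(\<Sum>x\<in>?B. scale_pm (f x) x) = 0" and "x \<in> ?B"
    then obtain a where a: "a \<in> M_index s k" "x = ?b a" by blast
    \<comment> \<open>Reading the linear relation at coordinate \<open>a\<close> isolates the
      coefficient of \<open>x\<close>.\<close>
    have "0 = Poly_Mapping.lookup (\<Sum>x\<in>?B. scale_pm (f x) x) a"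
      using sum by simp
    also have "\<dots> = (\<Sum>b\<in>M_index s k. if b = a then f (?b b) else 0)"
      by (subst sum.reindex[OF inj])
        (auto simp: lookup_sum lookup_scale_pm basis_vec_def lookup_single when_def intro!: sum.cong)
    also have "\<dots> = f x" using a finite_M_index by simp
    finally show "f x = 0" ..
  qed
  moreover have "M_space s k \<subseteq> pm.span ?B"
  proof
    fix v :: "_ \<Rightarrow>\<^sub>0 'k" assume "v \<in> M_space s k"
    then show "v \<in> pm.span ?B"
    proof (induction v rule: M_space_induct)
      case (single a c)
      have "scale_pm c (?b a) \<in> pm.span ?B"
        using single by (intro pm.span_scale pm.span_base) auto
      then show ?case by (simp add: basis_vec_def scale_pm_single)
    qed (auto intro: pm.span_zero pm.span_add)
  qed
  moreover have "?B \<subseteq> M_space s k"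
    by (auto simp: basis_vec_def M_space_def)
  moreover have "card ?B = (\<Prod>i = 1..s. k i)"
    by (simp add: card_image[OF inj] card_M_index)
  ultimately show ?thesis by (intro pm.dim_unique)
qed

end


section \<open>Transport along an algebra isomorphism\<close>

lemma algebra_isoD:
  assumes "\<phi> \<in> algebra_iso A B"
  shows "bij_betw \<phi> (carrier A) (carrier B)"
    and "x \<in> carrier A \<Longrightarrow> \<phi> x \<in> carrier B"
    and "x \<in> carrier A \<Longrightarrow> y \<in> carrier A \<Longrightarrow> \<phi> (x \<otimes>\<^bsub>A\<^esub> y) = \<phi> x \<otimes>\<^bsub>B\<^esub> \<phi> y"
    and "x \<in> carrier A \<Longrightarrow> y \<in> carrier A \<Longrightarrow> \<phi> (x \<oplus>\<^bsub>A\<^esub> y) = \<phi> x \<oplus>\<^bsub>B\<^esub> \<phi> y"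
    and "\<phi> \<one>\<^bsub>A\<^esub> = \<one>\<^bsub>B\<^esub>"
    and "x \<in> carrier A \<Longrightarrow> \<phi> (c \<odot>\<^bsub>A\<^esub> x) = c \<odot>\<^bsub>B\<^esub> \<phi> x"
  using assms by (simp_all add: algebra_iso_def ring_iso_def ring_hom_def Pi_iff)

lemma right_module_scale:
  assumes "right_module A scl V act" "v \<in> V" "x \<in> carrier A"
  shows "act (scl c v) x = scl c (act v x)" "act v (c \<odot>\<^bsub>A\<^esub> x) = scl c (act v x)"
  using assms by (simp_all add: right_module_def)

lemma right_module_one: "right_module A scl V act \<Longrightarrow> v \<in> V \<Longrightarrow> act v \<one>\<^bsub>A\<^esub> = v"
  by (simp add: right_module_def)

text \<open>Used in both directions: from the normal form to the given torus to construct the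
  action, and back to compare a competing action with it.\<close>

lemma right_module_pullback:
  assumes \<phi>: "\<phi> \<in> algebra_iso A B" and mod: "right_module B scl V act"
  shows "right_module A scl V (\<lambda>v x. act v (\<phi> x))"
  using mod unfolding right_module_def
  by (simp add: algebra_isoD[OF \<phi>])

lemma quantum_torus_closed:
  fixes Q :: "nat \<Rightarrow> nat \<Rightarrow> 'k::field" and c :: 'k
  assumes "x \<in> carrier (quantum_torus n Q)" "y \<in> carrier (quantum_torus n Q)"
  shows "x \<oplus>\<^bsub>quantum_torus n Q\<^esub> y \<in> carrier (quantum_torus n Q)"
    and "x \<otimes>\<^bsub>quantum_torus n Q\<^esub> y \<in> carrier (quantum_torus n Q)"
    and "c \<odot>\<^bsub>quantum_torus n Q\<^esub> x \<in> carrier (quantum_torus n Q)"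
proof -
  obtain p r where p: "p \<in> carrier (free_algebra n)" "x = torus_class n Q p"
    and r: "r \<in> carrier (free_algebra n)" "y = torus_class n Q r"
    using assms unfolding carrier_quantum_torus by blast
  have "p + r \<in> carrier (free_algebra n)" "p * r \<in> carrier (free_algebra n)"
    using p(1) r(1) by (simp_all add: free_algebra_def free_algebra_mult_closed keys_add_subset)
  then show "x \<oplus>\<^bsub>quantum_torus n Q\<^esub> y \<in> carrier (quantum_torus n Q)"
    and "x \<otimes>\<^bsub>quantum_torus n Q\<^esub> y \<in> carrier (quantum_torus n Q)"
    and "c \<odot>\<^bsub>quantum_torus n Q\<^esub> x \<in> carrier (quantum_torus n Q)"
    using p r by (simp_all add: quantum_torus_add quantum_torus_mult quantum_torus_smult
        torus_class_in_carrier scale_in_free_algebra)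
qed

lemma quantum_torus_one_closed: "\<one>\<^bsub>quantum_torus n Q\<^esub> \<in> carrier (quantum_torus n Q)"
  by (simp add: quantum_torus_one torus_class_in_carrier one_in_free_algebra)

text \<open>\<open>inv_into\<close> undoes the isomorphism on the carrier only, so each homomorphism
  law relies on the carrier of the quantum torus being closed under the operations.\<close>

lemma algebra_iso_inv:
  assumes \<phi>: "\<phi> \<in> algebra_iso (quantum_torus n N) B"
  shows "inv_into (carrier (quantum_torus n N)) \<phi> \<in> algebra_iso B (quantum_torus n N)"
proof -
  let ?A = "quantum_torus n N" and ?\<psi> = "inv_into (carrier (quantum_torus n N)) \<phi>"
  note hom = algebra_isoD[OF \<phi>]
  have bij: "bij_betw ?\<psi> (carrier B) (carrier ?A)" by (rule bij_betw_inv_into[OF hom(1)])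
  have inv: "?\<psi> (\<phi> x) = x" if "x \<in> carrier ?A" for x
    using bij_betw_inv_into_left[OF hom(1) that] .
  have surj: "\<exists>x'\<in>carrier ?A. x = \<phi> x'" if "x \<in> carrier B" for x
    using that hom(1) by (auto simp: bij_betw_def)
  have "?\<psi> (x \<otimes>\<^bsub>B\<^esub> y) = ?\<psi> x \<otimes>\<^bsub>?A\<^esub> ?\<psi> y" "?\<psi> (x \<oplus>\<^bsub>B\<^esub> y) = ?\<psi> x \<oplus>\<^bsub>?A\<^esub> ?\<psi> y"
    if xy: "x \<in> carrier B" "y \<in> carrier B" for x y
  proof -
    obtain x' y' where "x' \<in> carrier ?A" "x = \<phi> x'" "y' \<in> carrier ?A" "y = \<phi> y'"
      using surj xy by blast
    then show "?\<psi> (x \<otimes>\<^bsub>B\<^esub> y) = ?\<psi> x \<otimes>\<^bsub>?A\<^esub> ?\<psi> y" "?\<psi> (x \<oplus>\<^bsub>B\<^esub> y) = ?\<psi> x \<oplus>\<^bsub>?A\<^esub> ?\<psi> y"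
      by (simp_all add: hom(3,4)[symmetric] inv quantum_torus_closed)
  qed
  moreover have "?\<psi> (c \<odot>\<^bsub>B\<^esub> x) = c \<odot>\<^bsub>?A\<^esub> ?\<psi> x" if x: "x \<in> carrier B" for c x
  proof -
    obtain x' where "x' \<in> carrier ?A" "x = \<phi> x'" using surj x by blast
    then show ?thesis
      by (simp add: hom(6)[symmetric] inv quantum_torus_closed)
  qed
  moreover have "?\<psi> \<one>\<^bsub>B\<^esub> = \<one>\<^bsub>?A\<^esub>"
    using inv[OF quantum_torus_one_closed] hom(5) by simp
  ultimately show ?thesis
    using bij by (simp add: algebra_iso_def ring_iso_def ring_hom_def bij_betw_apply)
qed


section \<open>The order of \<open>q\<close>\<close>

lemma group_unit_group: "group (unit_group :: 'k::field monoid)"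
proof (rule groupI)
  fix x :: 'k assume "x \<in> carrier unit_group"
  then show "\<exists>y\<in>carrier unit_group. y \<otimes>\<^bsub>unit_group\<^esub> x = \<one>\<^bsub>unit_group\<^esub>"
    by (intro bexI[of _ "inverse x"]) (simp_all add: unit_group_def)
qed (simp_all add: unit_group_def)

lemma unit_group_pow: "(x :: 'k::field) [^]\<^bsub>unit_group\<^esub> (r::nat) = x ^ r"
  by (induction r) (simp_all add: unit_group_def nat_pow_def)

text \<open>The order of \<open>q\<close> is the cardinality of the group it generates. Infinite
  order is covered too: the cardinality is then 0, which divides only 0.\<close>

lemma power_eq_one_iff_card_generate:
  fixes q :: "'k::field"
  assumes "q \<noteq> 0"
  shows "q ^ r = 1 \<longleftrightarrow> card (generate unit_group {q}) dvd r"
proof -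
  interpret group "unit_group :: 'k monoid" by (rule group_unit_group)
  have "q \<in> carrier unit_group" using assms by (simp add: unit_group_def)
  then show ?thesis
    using pow_eq_id[of q r] generate_pow_card[of q]
    by (simp add: unit_group_pow) (simp add: unit_group_def)
qed

text \<open>If two powers with exponents \<open>x \<le> y\<close> below \<open>m div h\<close>
  agree, then \<open>m\<close> divides \<open>h * (y - x)\<close>, which is smaller than
  \<open>m\<close> and hence 0.\<close>

lemma primitive_root_power:
  fixes q :: "'k::field"
  assumes q: "q \<noteq> 0" and order: "\<And>r. q ^ r = 1 \<longleftrightarrow> m dvd r" and h: "h dvd m" "0 < m"
  shows "(q ^ h) ^ (m div h) = 1" "inj_on (\<lambda>x. (q ^ h) ^ x) {0..<m div h}"
proof -
  show "(q ^ h) ^ (m div h) = 1"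
    using order[of m] h by (simp flip: power_mult)
  have "0 < h" using h dvd_pos_nat by blast
  have eq: "x = y" if "x \<le> y" "y < m div h" "(q ^ h) ^ x = (q ^ h) ^ y" for x y
  proof -
    have "(q ^ h) ^ y = (q ^ h) ^ x * (q ^ h) ^ (y - x)"
      using that(1) by (simp flip: power_add)
    then have "(q ^ h) ^ (y - x) = 1" using that(3) q by simp
    then have "m dvd h * (y - x)" by (simp add: order flip: power_mult)
    moreover have "h * (y - x) < m"
    proof -
      have "h * (y - x) < h * (m div h)" using that(2) \<open>0 < h\<close> by simp
      then show ?thesis using h by simp
    qed
    ultimately have "h * (y - x) = 0" using nat_dvd_not_less by blast
    then show ?thesis using \<open>0 < h\<close> that(1) by simp
  qed
  show "inj_on (\<lambda>x. (q ^ h) ^ x) {0..<m div h}"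
  proof (rule inj_onI)
    fix x y assume xy: "x \<in> {0..<m div h}" "y \<in> {0..<m div h}" "(q ^ h) ^ x = (q ^ h) ^ y"
    then show "x = y" using eq[of x y] eq[of y x] by (cases "x \<le> y") auto
  qed
qed


section \<open>The simple module \<open>M(\<alpha>)\<close>\<close>

theorem theoremA:
  fixes n m s :: nat
    and Q :: "nat \<Rightarrow> nat \<Rightarrow> 'k::alg_closed_field"
    and q :: 'k
    and h k :: "nat \<Rightarrow> nat"
    and \<phi> :: "(word \<Rightarrow>\<^sub>0 'k) set \<Rightarrow> (word \<Rightarrow>\<^sub>0 'k) set"
    and X :: "nat \<Rightarrow> (word \<Rightarrow>\<^sub>0 'k) set"
    and \<alpha> :: "nat \<Rightarrow> 'k"
  assumes Q: "mult_antisymmetric n Q"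
    and torsion: "\<forall>g\<in>entry_group n Q. \<exists>r>0. g ^ r = 1"
    and m: "m = card (entry_group n Q)"
    and q: "q \<noteq> 0" "entry_group n Q = generate unit_group {q}"
    and s: "2 * s \<le> n"
    and h_one: "h 1 = 1"
    and h_div: "\<forall>i\<in>{1..s}. 0 < h i \<and> h i dvd m \<and> h i < m"
    and h_chain: "\<forall>i. 2 \<le> i \<and> i < s \<longrightarrow> h i dvd h (i + 1)"
    and \<phi>: "\<phi> \<in> algebra_iso (quantum_torus n (normal_matrix q s h)) (quantum_torus n Q)"
    and X: "\<forall>i\<in>{1..n}. X i = \<phi> (torus_gen n (normal_matrix q s h) i)"
    and X_monomial: "\<forall>i\<in>{1..n}. X i \<in> torus_monomials n Q"
    and k: "\<forall>i\<in>{1..s}. k i = m div h i"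
    and \<alpha>: "\<forall>i\<in>{1..n}. \<alpha> i \<noteq> 0"
  shows "\<exists>act.
      M_action (quantum_torus n Q) X n s q h k \<alpha> act \<and>
      (\<forall>act'. M_action (quantum_torus n Q) X n s q h k \<alpha> act' \<longrightarrow>
         (\<forall>v\<in>M_space s k. \<forall>x\<in>carrier (quantum_torus n Q). act' v x = act v x)) \<and>
      simple_right_module (quantum_torus n Q) scale_pm (M_space s k) act \<and>
      vector_space.dim (scale_pm :: 'k \<Rightarrow> _) (M_space s k) = (\<Prod>i = 1..s. k i)"
proof -
  let ?N = "normal_matrix q s h" and ?A = "quantum_torus n Q"
    and ?M = "M_space s k :: ((nat \<Rightarrow> nat) \<Rightarrow>\<^sub>0 'k) set"
  let ?B = "quantum_torus n ?N"
  have order: "q ^ r = 1 \<longleftrightarrow> m dvd r" for r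
    using power_eq_one_iff_card_generate[OF q(1)] by (simp add: m q(2))
  \<comment> \<open>Torsion excludes the value \<open>m = 0\<close>, which would be the cardinality
    of an infinite group.\<close>
  have "q \<in> entry_group n Q" unfolding q(2) by (rule generate.incl) simp
  then obtain r where "0 < r" "q ^ r = 1" using torsion by blast
  then have m_pos: "0 < m" using order dvd_pos_nat by blast
  interpret M_operators n s q h k \<alpha>
  proof
    fix i assume i: "i \<in> {1..s}"
    have h: "0 < h i" "h i dvd m" and k': "k i = m div h i" using h_div k i by auto
    show "0 < k i" using h m_pos by (simp add: k' div_greater_zero_iff dvd_imp_le)
    show "(q ^ h i) ^ k i = 1" "inj_on (\<lambda>x. (q ^ h i) ^ x) {0..<k i}"
      unfolding k' by (rule primitive_root_power[OF q(1) order h(2) m_pos])+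
  qed (use s q(1) \<alpha> in auto)
  define \<psi> where "\<psi> = inv_into (carrier ?B) \<phi>"
  have \<psi>: "\<psi> \<in> algebra_iso ?A ?B" unfolding \<psi>_def by (rule algebra_iso_inv[OF \<phi>])
  have \<psi>\<phi>: "\<psi> (\<phi> x) = x" if "x \<in> carrier ?B" for x
    unfolding \<psi>_def by (rule bij_betw_inv_into_left[OF algebra_isoD(1)[OF \<phi>] that])
  have \<phi>\<psi>: "\<phi> (\<psi> x) = x" if "x \<in> carrier ?A" for x
    unfolding \<psi>_def by (rule bij_betw_inv_into_right[OF algebra_isoD(1)[OF \<phi>] that])
  \<comment> \<open>An element of the given torus acts through its preimage in the normal
    form.\<close>
  define act where "act v x = torus_act v (\<psi> x)" for v x
  have gen: "torus_gen n ?N i \<in> carrier ?B" if "i \<in> {1..n}" for i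
    unfolding torus_gen_def using that by (intro torus_class_in_carrier mono_word_in_free_algebra) auto
  have X_in: "X i \<in> carrier ?A" if "i \<in> {1..n}" for i
    using X gen[OF that] algebra_isoD(2)[OF \<phi>] that by simp
  have mod: "right_module ?A scale_pm ?M act"
    unfolding act_def by (rule right_module_pullback[OF \<psi> right_module_torus_act])
  have act_X: "act v (X i) = M_op (Gen i) v" if "v \<in> ?M" "i \<in> {1..n}" for v i
    using that X \<psi>\<phi>[OF gen] by (simp add: act_def torus_act_gen)
  have basis: "basis_vec a \<in> ?M" if "a \<in> M_index s k" for a
    unfolding basis_vec_def by (rule single_in_M_space[OF that])
  have index: "i \<in> {1..n}" "i + s \<in> {1..n}" if "i \<in> {1..s}" for i
    using that s by auto
  have index': "2 * s + j \<in> {1..n}" if "j \<in> {1..n - 2 * s}" for j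
    using that by auto
  have "M_action ?A X n s q h k \<alpha> act"
    unfolding M_action_def
  proof (intro conjI ballI)
    fix a i assume a: "a \<in> M_index s k" and i: "i \<in> {1..s}"
    show "act (basis_vec a) (X i) = scale_pm (\<alpha> i) (basis_vec (shift k i 1 a))"
      by (simp only: act_X[OF basis[OF a] index(1)[OF i]] M_op_on_basis(1)[OF a i])
    show "act (basis_vec a) (X (i + s)) =
        scale_pm (inverse (\<alpha> i) * \<alpha> (i + s) * (q ^ h i) powi (int (a i) - 1))
          (basis_vec (shift k i (- 1) a))"
      by (simp only: act_X[OF basis[OF a] index(2)[OF i]] M_op_on_basis(2)[OF a i])
  next
    fix a j assume a: "a \<in> M_index s k" and j: "j \<in> {1..n - 2 * s}"
    then have "1 \<le> j" by simp
    then show "act (basis_vec a) (X (2 * s + j)) = scale_pm (\<alpha> (2 * s + j)) (basis_vec a)"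
      by (simp only: act_X[OF basis[OF a] index'[OF j]] M_op_on_basis(3)[OF a])
  qed (rule mod)
  moreover have "act' v x = act v x"
    if act': "M_action ?A X n s q h k \<alpha> act'" and v: "v \<in> ?M" and x: "x \<in> carrier ?A" for act' v x
  proof -
    have mod': "right_module ?A scale_pm ?M act'" using act' by (simp add: M_action_def)
    have "act' u (X i) = M_op (Gen i) u" if u: "u \<in> ?M" and i: "i \<in> {1..n}" for u i
    proof (rule M_op_determined[where T = "\<lambda>i u. act' u (X i)", OF _ _ _ u])
      fix a assume a: "a \<in> M_index s k"
      \<comment> \<open>Every generator is of exactly the kinds prescribed by
        \<open>M_action\<close>: a shift forward, a shift backward or a scalar.\<close>
      consider "i \<in> {1..s}" | j where "i = j + s" "j \<in> {1..s}"
        | j where "i = 2 * s + j" "j \<in> {1..n - 2 * s}"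
      proof -
        consider "i \<le> s" | "s < i" "i \<le> 2 * s" | "2 * s < i" by linarith
        then show thesis
        proof cases
          case 1
          then show thesis using that(1) i by simp
        next
          case 2
          then show thesis by (intro that(2)[of "i - s"]) auto
        next
          case 3
          then show thesis using i by (intro that(3)[of "i - 2 * s"]) auto
        qed
      qed
      then show "act' (basis_vec a) (X i) = M_op (Gen i) (basis_vec a)"
        using act' a unfolding M_action_def by cases (simp_all add: M_op_on_basis)
    qed (use mod' X_in[OF i] in \<open>simp_all add: right_module_def\<close>)
    \<comment> \<open>Pulled back to the normal form, \<open>act'\<close> has the prescribed
      operators as generators, so \<open>torus_act_unique\<close> determines it.\<close>
    then have "act' v (\<phi> (\<psi> x)) = torus_act v (\<psi> x)"
      using X v algebra_isoD(2)[OF \<psi> x]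
      by (intro torus_act_unique[OF right_module_pullback[OF \<phi> mod']]) auto
    then show ?thesis using x by (simp add: \<phi>\<psi> act_def)
  qed
  moreover have "simple_right_module ?A scale_pm ?M act"
    unfolding simple_right_module_def
  proof (intro conjI allI impI)
    show "right_module ?A scale_pm ?M act" by (rule mod)
    obtain a where "a \<in> M_index s k" using M_index_nonempty by blast
    then have "basis_vec a \<in> ?M" by (rule basis)
    moreover have "basis_vec a \<noteq> (0 :: _ \<Rightarrow>\<^sub>0 'k)"
      by (metis basis_vec_def lookup_single_eq lookup_zero zero_neq_one)
    ultimately show "?M \<noteq> {0}" by blast
    fix W assume W: "right_submodule ?A ?M act W"
    have sub: "W \<subseteq> ?M" and act_W: "\<And>v x. v \<in> W \<Longrightarrow> x \<in> carrier ?A \<Longrightarrow> act v x \<in> W"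
      using W by (auto simp: right_submodule_def)
    note one = quantum_torus_one_closed[of n Q]
    \<comment> \<open>Closure under scalars is not part of \<open>right_submodule\<close>; it
      follows because \<open>c\<close> acts as the algebra element \<open>c\<close> times the
      unit.\<close>
    have "scale_pm c v \<in> W" if v: "v \<in> W" for c v
    proof -
      have vM: "v \<in> ?M" using v sub by blast
      have "act v (c \<odot>\<^bsub>?A\<^esub> \<one>\<^bsub>?A\<^esub>) = scale_pm c v"
        by (simp only: right_module_scale(2)[OF mod vM one] right_module_one[OF mod vM])
      with act_W[OF v quantum_torus_closed(3)[OF one one], of c] show ?thesis by (simp only:)
    qed
    then have "pm.subspace W"
      using W unfolding right_submodule_def by (intro pm.subspaceI) blast+
    then show "W = {0} \<or> W = ?M"
    proof (rule submodule_trivial[OF _ sub])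
      fix i v assume i: "i \<in> {1..2 * s}" and v: "v \<in> W"
      then have "i \<in> {1..n}" using s by auto
      then show "M_op (Gen i) v \<in> W"
        using act_X[of v i] act_W[OF v X_in, of i] v sub by (simp add: subsetD)
    qed
  qed
  moreover note dim_M_space
  ultimately show ?thesis by blast
qed

end
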